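(* Let $V$ be a finite-dimensional real Euclidean space, let $\Gamma\subset V$ be a dense subgroup which is a free abelian group of finite rank, acting on $V$ by translations, and let $\mathcal W=\{W_1,\dots,W_f\}$ be a finite family of affine hyperplanes of $V$ whose normal vectors span $V$. Put $\mathcal C=\{W+\gamma: W\in\mathcal W,\ \gamma\in\Gamma\}$. Suppose that the number $L_0$ of $\Gamma$-orbits of singular points is finite. Then for every $p$, the rational vector space $H_p(\Gamma, CV_{\mathcal C})\otimes\mathbb Q$ is finite dimensional.
   Context: A singular space (or singular $l$-space) is an affine subspace of $V$ of dimension $l<\dim V$ which is a nonempty intersection of elements of $\mathcal C$; singular points are singular $0$-spaces, and $\Gamma$ acts on singular spaces by translation. A $\mathcal C$-tope is a compact polytope in $V$ which is the closure of its interior and each of whose $(\dim V-1)$-dimensional faces is contained in some element of $\mathcal C$. Let $V'=V\setminus\bigcup_{W\in\mathcal C}W$. $CV_{\mathcal C}$ denotes the ring of integer-valued functions on $V'$ generated (under pointwise addition and multiplication) by the indicator functions of the sets $P\cap V'$, $P$ a $\mathcal C$-tope; it is a $\mathbb Z[\Gamma]$-module via translation. $H_p(\Gamma,\cdot)$ is group homology. *)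

theory Defs
  imports "HOL-Analysis.Analysis"
begin

definition int_span :: "'v::euclidean_space set \<Rightarrow> 'v set" where
  "int_span B = {(\<Sum>b\<in>B. real_of_int (c b) *\<^sub>R b) | c. True}"

definition int_independent :: "'v::euclidean_space set \<Rightarrow> bool" where
  "int_independent B \<longleftrightarrow>
     (\<forall>c::'v \<Rightarrow> int. (\<Sum>b\<in>B. real_of_int (c b) *\<^sub>R b) = 0 \<longrightarrow> (\<forall>b\<in>B. c b = 0))"

definition hyp :: "(nat \<Rightarrow> 'v::euclidean_space) \<Rightarrow> (nat \<Rightarrow> real) \<Rightarrow> nat \<Rightarrow> 'v set" where
  "hyp a b i = {x. a i \<bullet> x = b i}"

definition Cfam :: "'v::euclidean_space set \<Rightarrow> (nat \<Rightarrow> 'v) \<Rightarrow> (nat \<Rightarrow> real) \<Rightarrow> nat \<Rightarrow> 'v set set" where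
  "Cfam \<Gamma> a b f = {(\<lambda>x. x + g) ` hyp a b i | i g. i < f \<and> g \<in> \<Gamma>}"

definition singular_points :: "'v::euclidean_space set set \<Rightarrow> 'v set" where
  "singular_points C = {x. \<exists>S. S \<subseteq> C \<and> S \<noteq> {} \<and> \<Inter>S = {x}}"

definition Gamma_orbit :: "'v::euclidean_space set \<Rightarrow> 'v \<Rightarrow> 'v set" where
  "Gamma_orbit \<Gamma> x = {x + g | g. g \<in> \<Gamma>}"

definition Ctope :: "'v::euclidean_space set set \<Rightarrow> 'v set \<Rightarrow> bool" where
  "Ctope C P \<longleftrightarrow> compact P \<and> polytope P \<and> closure (interior P) = P \<and>
     (\<forall>F. F facet_of P \<longrightarrow> (\<exists>W\<in>C. F \<subseteq> W))"

text \<open>V' = V minus the union of C; functions on V' are represented as functions on V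
  vanishing outside V'.\<close>
definition Vprime :: "'v::euclidean_space set set \<Rightarrow> 'v set" where
  "Vprime C = UNIV - \<Union>C"

inductive_set CV :: "'v::euclidean_space set set \<Rightarrow> ('v \<Rightarrow> int) set" for C where
  ind: "Ctope C P \<Longrightarrow> (\<lambda>x. if x \<in> P \<inter> Vprime C then 1 else 0) \<in> CV C"
| zero: "(\<lambda>x. 0) \<in> CV C"
| add: "\<phi> \<in> CV C \<Longrightarrow> \<psi> \<in> CV C \<Longrightarrow> (\<lambda>x. \<phi> x + \<psi> x) \<in> CV C"
| neg: "\<phi> \<in> CV C \<Longrightarrow> (\<lambda>x. - \<phi> x) \<in> CV C"
| mult: "\<phi> \<in> CV C \<Longrightarrow> \<psi> \<in> CV C \<Longrightarrow> (\<lambda>x. \<phi> x * \<psi> x) \<in> CV C"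

text \<open>Standard (bar) complex computing H_p(Gamma, M) for M = CV_C, with Gamma acting by
  translation (g . phi)(x) = phi(x - g).  A p-chain is a finitely supported function from
  p-tuples (lists of length p) of elements of Gamma to M:  c = sum m_gs [g_1|...|g_p].\<close>
definition chains :: "'v::euclidean_space set \<Rightarrow> ('v \<Rightarrow> int) set \<Rightarrow> nat
    \<Rightarrow> ('v list \<Rightarrow> 'v \<Rightarrow> int) set" where
  "chains \<Gamma> M p = {c. finite {gs. c gs \<noteq> (\<lambda>x. 0)} \<and> (\<forall>gs. c gs \<in> M) \<and>
      (\<forall>gs. c gs \<noteq> (\<lambda>x. 0) \<longrightarrow> length gs = p \<and> set gs \<subseteq> \<Gamma>)}"

definition dface :: "nat \<Rightarrow> 'v::euclidean_space list \<Rightarrow> 'v list" where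
  "dface i gs = (if i = 0 then tl gs
      else if i < length gs then take (i - 1) gs @ [gs ! (i - 1) + gs ! i] @ drop (i + 1) gs
      else butlast gs)"

definition dcoef :: "nat \<Rightarrow> 'v::euclidean_space list \<Rightarrow> ('v \<Rightarrow> int) \<Rightarrow> 'v \<Rightarrow> int" where
  "dcoef i gs m x = (if i = 0 then m (x - hd gs) else (-1) ^ i * m x)"

definition bd :: "('v::euclidean_space list \<Rightarrow> 'v \<Rightarrow> int) \<Rightarrow> 'v list \<Rightarrow> 'v \<Rightarrow> int" where
  "bd c hs x = (\<Sum>gs\<in>{gs. c gs \<noteq> (\<lambda>x. 0) \<and> gs \<noteq> []}.
       \<Sum>i\<in>{0..length gs}. if dface i gs = hs then dcoef i gs (c gs) x else 0)"

definition cycles :: "'v::euclidean_space set \<Rightarrow> ('v \<Rightarrow> int) set \<Rightarrow> nat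
    \<Rightarrow> ('v list \<Rightarrow> 'v \<Rightarrow> int) set" where
  "cycles \<Gamma> M p = {z \<in> chains \<Gamma> M p. bd z = (\<lambda>hs x. 0)}"

text \<open>H_p(Gamma, M) \<otimes> Q is finite dimensional, unfolded: there are finitely many cycles
  whose classes span H_p(Gamma,M) \<otimes> Q, i.e. every cycle has a nonzero integer multiple which
  is homologous to an integer combination of them.\<close>
definition homology_rat_fin_dim :: "'v::euclidean_space set \<Rightarrow> ('v \<Rightarrow> int) set \<Rightarrow> nat \<Rightarrow> bool" where
  "homology_rat_fin_dim \<Gamma> M p \<longleftrightarrow>
     (\<exists>S. finite S \<and> S \<subseteq> cycles \<Gamma> M p \<and>
        (\<forall>z\<in>cycles \<Gamma> M p. \<exists>n::int. n \<noteq> 0 \<and> (\<exists>k. \<exists>w\<in>chains \<Gamma> M (Suc p).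
            (\<lambda>gs x. n * z gs x - (\<Sum>s\<in>S. k s * s gs x)) = bd w)))"

end

theory Submission
  imports Defs "HOL-Library.Poly_Mapping" "HOL-Library.Function_Algebras"
begin

text \<open>
  The homology of a free abelian group \<open>\<Gamma>\<close> of finite rank with coefficients in a finitely
  generated \<open>\<int>[\<Gamma>]\<close>-module is finitely generated: \<open>\<int>[\<Gamma>]\<close> is Noetherian, so one can shift
  dimensions along \<open>0 \<rightarrow> K \<rightarrow> F \<rightarrow> N \<rightarrow> 0\<close> with \<open>F\<close> free and \<open>K\<close> finitely generated.
  It therefore suffices to embed the module of C-tope functions into a finitely generated one.

  On \<open>V'\<close> every C-tope is a finite intersection of half-spaces bounded by hyperplanes of \<open>\<C>\<close>.
  If the normals of such half-spaces are linearly dependent, then inclusion-exclusion writes the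
  indicator function of the intersection as an integral combination of those of intersections of
  fewer of them. So only half-spaces with linearly independent normals are needed; their bounding
  hyperplanes pass through a common singular point, and up to translation by \<open>\<Gamma>\<close> there are
  finitely many of these.
\<close>

section \<open>Noetherian modules over finitely generated abelian groups\<close>

text \<open>C-topes of all sizes occur, so they suggest no finite list of generators for
  \<open>CV\<close> over Z[\<Gamma>]. Unbounded cones avoid this: a cone is fixed by a point on its
  walls and by the normals used, so finitely many orbits of singular points leave finitely many
  cones up to translation. The price is that one only gets an inclusion of \<open>CV\<close> into
  the module of cones, and the Noetherian property turns this inclusion into finite generation.

  Modules are sets inside an ambient abelian group that are stable under a set of operators.
  Adjoining an operator \<open>t\<close> then produces a quotient of X[t] rather than X[t] itself,
  so Hilbert's argument has to cope with leading coefficients that are not unique.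

  Dimension shifting replaces a coefficient module by the kernel of a free cover. This kernel lies
  in the type of the free module, so after one step the induction stays within a single type. The
  outcome is integral: the homology is finitely generated over Z, and the rational statement holds
  with multiplier 1.\<close>

inductive_set gen :: "('m::ab_group_add \<Rightarrow> 'm) set \<Rightarrow> 'm set \<Rightarrow> 'm set" for A S where
  base: "x \<in> S \<Longrightarrow> x \<in> gen A S"
| zero: "0 \<in> gen A S"
| diff: "x \<in> gen A S \<Longrightarrow> y \<in> gen A S \<Longrightarrow> x - y \<in> gen A S"
| app: "t \<in> A \<Longrightarrow> x \<in> gen A S \<Longrightarrow> t x \<in> gen A S"

text \<open>With \<open>A = {}\<close> these are the subgroups; with \<open>A\<close> the
  translations by \<Gamma> they are the Z[\<Gamma>]-submodules.\<close>

definition submod :: "('m::ab_group_add \<Rightarrow> 'm) set \<Rightarrow> 'm set \<Rightarrow> bool" where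
  "submod A N \<longleftrightarrow> 0 \<in> N \<and> (\<forall>x\<in>N. \<forall>y\<in>N. x - y \<in> N) \<and> (\<forall>t\<in>A. \<forall>x\<in>N. t x \<in> N)"

text \<open>Finite generation of submodules is used in place of the ascending chain condition; an
  increasing chain is handled through its union.\<close>

definition noeth :: "('m::ab_group_add \<Rightarrow> 'm) set \<Rightarrow> 'm set \<Rightarrow> bool" where
  "noeth A X \<longleftrightarrow> (\<forall>N. N \<subseteq> X \<longrightarrow> submod A N \<longrightarrow> (\<exists>S. finite S \<and> N = gen A S))"

lemma noethE:
  assumes "noeth A X" "N \<subseteq> X" "submod A N"
  obtains S where "finite S" "N = gen A S"
  using assms by (auto simp: noeth_def)

lemma submodI:
  assumes "0 \<in> N" "\<And>x y. x \<in> N \<Longrightarrow> y \<in> N \<Longrightarrow> x - y \<in> N"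
    and "\<And>t x. t \<in> A \<Longrightarrow> x \<in> N \<Longrightarrow> t x \<in> N"
  shows "submod A N"
  using assms by (auto simp: submod_def)

lemma submod_zero: "submod A N \<Longrightarrow> 0 \<in> N"
  and submod_diff: "submod A N \<Longrightarrow> x \<in> N \<Longrightarrow> y \<in> N \<Longrightarrow> x - y \<in> N"
  and submod_app: "submod A N \<Longrightarrow> t \<in> A \<Longrightarrow> x \<in> N \<Longrightarrow> t x \<in> N"
  by (auto simp: submod_def)

lemma submod_uminus: "submod A N \<Longrightarrow> x \<in> N \<Longrightarrow> - x \<in> N"
  using submod_diff[of A N 0 x] submod_zero by auto

lemma submod_add: "submod A N \<Longrightarrow> x \<in> N \<Longrightarrow> y \<in> N \<Longrightarrow> x + y \<in> N"
  using submod_diff[of A N x "- y"] submod_uminus by auto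

lemma submod_sum: "submod A N \<Longrightarrow> (\<And>i. i \<in> I \<Longrightarrow> f i \<in> N) \<Longrightarrow> sum f I \<in> N"
  by (induction I rule: infinite_finite_induct) (auto simp: submod_zero submod_add)

lemma submod_funpow: "submod A N \<Longrightarrow> t \<in> A \<Longrightarrow> x \<in> N \<Longrightarrow> (t ^^ n) x \<in> N"
  by (induction n) (auto intro: submod_app)

lemma submod_mono: "submod A N \<Longrightarrow> A' \<subseteq> A \<Longrightarrow> submod A' N"
  by (auto simp: submod_def)

lemma submod_Int: "submod A N \<Longrightarrow> submod A M \<Longrightarrow> submod A (N \<inter> M)"
  by (auto simp: submod_def)

lemma submod_gen: "submod A (gen A S)"
  by (auto simp: submod_def intro: gen.intros)

lemma gen_minimal: "submod A N \<Longrightarrow> S \<subseteq> N \<Longrightarrow> gen A S \<subseteq> N"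
proof
  fix x assume "x \<in> gen A S" and *: "submod A N" "S \<subseteq> N"
  then show "x \<in> N"
    by (induction rule: gen.induct) (use * in \<open>auto simp: submod_def\<close>)
qed

lemma gen_superset: "S \<subseteq> gen A S"
  by (auto intro: gen.base)

lemma gen_mono: "A \<subseteq> A' \<Longrightarrow> S \<subseteq> S' \<Longrightarrow> gen A S \<subseteq> gen A' S'"
  using gen_minimal[OF submod_mono[OF submod_gen]] gen_superset[of S' A'] by blast

lemma gen_gen:
  assumes "A \<subseteq> A'"
  shows "gen A' (gen A S) = gen A' S"
proof
  show "gen A' (gen A S) \<subseteq> gen A' S"
    by (rule gen_minimal[OF submod_gen gen_mono[OF assms order_refl]])
  show "gen A' S \<subseteq> gen A' (gen A S)"
    using gen_mono[OF order_refl gen_superset] .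
qed

section \<open>Additive maps and Hilbert's basis theorem\<close>

lemma additive_funpow:
  fixes t :: "'m::ab_group_add \<Rightarrow> 'm"
  shows "Modules.additive t \<Longrightarrow> Modules.additive (t ^^ n)"
  by (induction n) (auto simp: Modules.additive_def)

lemma gen_image_additive:
  assumes "Modules.additive f"
  shows "f ` gen {} S = gen {} (f ` S)"
proof
  interpret Modules.additive f by fact
  have "submod {} {x. f x \<in> gen {} (f ` S)}"
    by (rule submodI) (auto simp: zero diff intro: gen.intros)
  then have "gen {} S \<subseteq> {x. f x \<in> gen {} (f ` S)}"
    by (rule gen_minimal) (auto intro: gen.base)
  then show "f ` gen {} S \<subseteq> gen {} (f ` S)"
    by auto
  have "submod {} (f ` gen {} S)"
  proof (rule submodI)
    show "0 \<in> f ` gen {} S"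
      by (metis gen.zero image_eqI zero)
    fix x y assume "x \<in> f ` gen {} S" "y \<in> f ` gen {} S"
    then obtain u v where "u \<in> gen {} S" "v \<in> gen {} S" "x = f u" "y = f v"
      by auto
    then show "x - y \<in> f ` gen {} S"
      using gen.diff[of u "{}" S v] diff[of u v] by (metis image_eqI)
  qed auto
  then show "gen {} (f ` S) \<subseteq> f ` gen {} S"
    by (rule gen_minimal) (auto intro: gen.base)
qed

text \<open>Level \<open>d\<close> consists of the polynomial expressions x_0 + t x_1 + ... +
  t^(d-1) x_(d-1) with coefficients in \<open>X\<close>, that is, of degree less than
  \<open>d\<close>. The value of such an expression need not determine its coefficients.\<close>

primrec degree_filtration :: "('m::ab_group_add \<Rightarrow> 'm) \<Rightarrow> 'm set \<Rightarrow> nat \<Rightarrow> 'm set" where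
  "degree_filtration t X 0 = {0}"
| "degree_filtration t X (Suc d) =
     {y + (t ^^ d) x | x y. x \<in> X \<and> y \<in> degree_filtration t X d}"

lemma funpow_commute:
  assumes "\<And>x. s (t x) = t (s x)"
  shows "s ((t ^^ n) x) = (t ^^ n) (s x)"
  by (induction n) (auto simp: assms)

lemma submod_degree_filtration:
  assumes A: "\<And>s. s \<in> A \<Longrightarrow> Modules.additive s" and t: "Modules.additive t"
    and comm: "\<And>s x. s \<in> A \<Longrightarrow> s (t x) = t (s x)" and X: "submod A X"
  shows "submod A (degree_filtration t X d)"
proof (induction d)
  case 0
  show ?case using A by (auto simp: submod_def additive.zero)
next
  case (Suc d)
  note td = additive_funpow[OF t, of d]
  show ?case
  proof (rule submodI)
    show "0 \<in> degree_filtration t X (Suc d)"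
      using submod_zero[OF X] submod_zero[OF Suc] additive.zero[OF td] by force
  next
    fix x y assume "x \<in> degree_filtration t X (Suc d)" "y \<in> degree_filtration t X (Suc d)"
    then obtain u v u' v' where *: "x = u + (t ^^ d) v" "y = u' + (t ^^ d) v'"
      "v \<in> X" "v' \<in> X" "u \<in> degree_filtration t X d" "u' \<in> degree_filtration t X d"
      by auto
    have "x - y = (u - u') + (t ^^ d) (v - v')"
      by (simp add: * additive.diff[OF td])
    then show "x - y \<in> degree_filtration t X (Suc d)"
      using submod_diff[OF X *(3,4)] submod_diff[OF Suc *(5,6)] by auto
  next
    fix s x assume s: "s \<in> A" and "x \<in> degree_filtration t X (Suc d)"
    then obtain u v where *: "x = u + (t ^^ d) v" "v \<in> X" "u \<in> degree_filtration t X d"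
      by auto
    have "s x = s u + (t ^^ d) (s v)"
      using comm[OF s] by (simp add: * additive.add[OF A[OF s]] funpow_commute)
    then show "s x \<in> degree_filtration t X (Suc d)"
      using submod_app[OF X s] submod_app[OF Suc s] * by auto
  qed
qed

lemma degree_filtration_app:
  assumes t: "Modules.additive t" and X: "0 \<in> X"
  shows "y \<in> degree_filtration t X d \<Longrightarrow> t y \<in> degree_filtration t X (Suc d)"
proof (induction d arbitrary: y)
  case 0
  then show ?case using X by (auto simp: additive.zero[OF t])
next
  case (Suc d)
  then obtain u v where *: "y = u + (t ^^ d) v" "v \<in> X" "u \<in> degree_filtration t X d"
    by auto
  have "t y = t u + (t ^^ Suc d) v"
    by (simp add: * additive.add[OF t])
  then show ?case
    using Suc.IH[OF *(3)] *(2) unfolding degree_filtration.simps(2)[of t X "Suc d"] by blast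
qed

lemma degree_filtration_mono:
  assumes t: "Modules.additive t" and X: "0 \<in> X" and "d \<le> e"
  shows "degree_filtration t X d \<subseteq> degree_filtration t X e"
  using \<open>d \<le> e\<close>
proof (induction e rule: dec_induct)
  case (step e)
  have "(t ^^ e) 0 = 0"
    using additive.zero[OF additive_funpow[OF t]] .
  then have "degree_filtration t X e \<subseteq> degree_filtration t X (Suc e)"
    using X by force
  with step show ?case by blast
qed auto

lemma gen_subset_degree_filtration:
  assumes A: "\<And>s. s \<in> A \<Longrightarrow> Modules.additive s" and t: "Modules.additive t"
    and comm: "\<And>s x. s \<in> A \<Longrightarrow> s (t x) = t (s x)" and X: "submod A X"
  shows "gen (insert t A) X \<subseteq> (\<Union>d. degree_filtration t X d)"
proof (rule gen_minimal)
  note sm = submod_degree_filtration[OF A t comm X]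
  note mono = degree_filtration_mono[OF t submod_zero[OF X]]
  show "submod (insert t A) (\<Union>d. degree_filtration t X d)"
  proof (rule submodI)
    show "0 \<in> (\<Union>d. degree_filtration t X d)"
      by (auto intro!: exI[of _ 0])
  next
    fix x y assume "x \<in> (\<Union>d. degree_filtration t X d)" "y \<in> (\<Union>d. degree_filtration t X d)"
    then obtain d e where "x \<in> degree_filtration t X d" "y \<in> degree_filtration t X e"
      by auto
    then have "x \<in> degree_filtration t X (max d e)" "y \<in> degree_filtration t X (max d e)"
      using mono[of d "max d e"] mono[of e "max d e"] by auto
    then show "x - y \<in> (\<Union>d. degree_filtration t X d)"
      using submod_diff[OF sm] by blast
  next
    fix s x assume s: "s \<in> insert t A" and "x \<in> (\<Union>d. degree_filtration t X d)"
    then obtain d where d: "x \<in> degree_filtration t X d" by auto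
    have "s x \<in> degree_filtration t X (Suc d) \<or> s x \<in> degree_filtration t X d"
      using s submod_app[OF sm _ d] degree_filtration_app[OF t submod_zero[OF X] d] by auto
    then show "s x \<in> (\<Union>d. degree_filtration t X d)" by blast
  qed
  have "x \<in> degree_filtration t X (Suc 0)" if "x \<in> X" for x
    using that by simp
  then show "X \<subseteq> (\<Union>d. degree_filtration t X d)" by blast
qed

text \<open>Hilbert's basis theorem. The leading coefficients of the elements of \<open>N\<close> in degree \<open>d\<close>
  form an increasing sequence of submodules of \<open>X\<close>.\<close>
proposition noeth_insert:
  assumes A: "\<And>s. s \<in> A \<Longrightarrow> Modules.additive s" and t: "Modules.additive t"
    and comm: "\<And>s x. s \<in> A \<Longrightarrow> s (t x) = t (s x)" and X: "submod A X" and noeth: "noeth A X"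
  shows "noeth (insert t A) (gen (insert t A) X)"
  unfolding noeth_def
proof (intro allI impI)
  fix N assume NX: "N \<subseteq> gen (insert t A) X" and N: "submod (insert t A) N"
  let ?Y = "degree_filtration t X"
  have NA: "submod A N"
    using N by (rule submod_mono) auto
  note Y = submod_degree_filtration[OF A t comm X]
  note tadd = additive_funpow[OF t]
  \<comment> \<open>An element of \<open>N\<close> may have several expressions in powers of
    \<open>t\<close>, so \<open>L d\<close> collects every \<open>x\<close> that occurs as
    coefficient of t^d in some expression of degree at most \<open>d\<close> for an element of
    \<open>N\<close>.\<close>
  define L where "L d = {x \<in> X. \<exists>n\<in>N. n - (t ^^ d) x \<in> ?Y d}" for d
  have L: "submod A (L d)" for d
  proof (rule submodI)
    show "0 \<in> L d"
      using submod_zero[OF X] submod_zero[OF N] submod_zero[OF Y[of d]]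
      by (auto simp: L_def additive.zero[OF tadd] intro!: bexI[of _ 0])
  next
    fix x y assume "x \<in> L d" "y \<in> L d"
    then obtain n m where *: "n \<in> N" "m \<in> N" "n - (t ^^ d) x \<in> ?Y d" "m - (t ^^ d) y \<in> ?Y d"
      "x \<in> X" "y \<in> X"
      by (auto simp: L_def)
    have "(n - m) - (t ^^ d) (x - y) = (n - (t ^^ d) x) - (m - (t ^^ d) y)"
      by (simp add: additive.diff[OF tadd])
    then have "(n - m) - (t ^^ d) (x - y) \<in> ?Y d"
      using submod_diff[OF Y *(3,4)] by (simp only:)
    then show "x - y \<in> L d"
      using submod_diff[OF N *(1,2)] submod_diff[OF X *(5,6)] unfolding L_def by blast
  next
    fix s x assume s: "s \<in> A" and "x \<in> L d"
    then obtain n where *: "n \<in> N" "n - (t ^^ d) x \<in> ?Y d" "x \<in> X"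
      by (auto simp: L_def)
    have "s n - (t ^^ d) (s x) = s (n - (t ^^ d) x)"
      using comm[OF s] by (simp add: additive.diff[OF A[OF s]] funpow_commute)
    then have "s n - (t ^^ d) (s x) \<in> ?Y d"
      using submod_app[OF Y s *(2)] by (simp only:)
    then show "s x \<in> L d"
      using submod_app[OF NA s *(1)] submod_app[OF X s *(3)] unfolding L_def by blast
  qed
  have LSuc: "L d \<subseteq> L (Suc d)" for d
  proof
    fix x assume "x \<in> L d"
    then obtain n where *: "n \<in> N" "n - (t ^^ d) x \<in> ?Y d" "x \<in> X"
      by (auto simp: L_def)
    have "t n - (t ^^ Suc d) x = t (n - (t ^^ d) x)"
      by (simp add: additive.diff[OF t])
    then have "t n - (t ^^ Suc d) x \<in> ?Y (Suc d)"
      using degree_filtration_app[OF t submod_zero[OF X] *(2)] by (simp only:)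
    moreover have "t n \<in> N"
      using submod_app[OF N _ *(1)] by simp
    ultimately show "x \<in> L (Suc d)"
      using *(3) unfolding L_def by blast
  qed
  have Lmono: "L d \<subseteq> L e" if "d \<le> e" for d e
    using lift_Suc_mono_le[of L d e] LSuc that by blast
  \<comment> \<open>The union has a finite generating set, which already lies in one
    \<open>L D\<close>; hence the chain is constant from \<open>D\<close> on.\<close>
  have "submod A (\<Union>d. L d)"
  proof (rule submodI)
    fix x y assume "x \<in> (\<Union>d. L d)" "y \<in> (\<Union>d. L d)"
    then obtain d e where "x \<in> L d" "y \<in> L e"
      by auto
    then have "x \<in> L (max d e)" "y \<in> L (max d e)"
      using Lmono[of d "max d e"] Lmono[of e "max d e"] by auto
    then show "x - y \<in> (\<Union>d. L d)"
      using submod_diff[OF L] by blast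
  next
    show "0 \<in> (\<Union>d. L d)"
      using submod_zero[OF L] by blast
  next
    fix s x assume s: "s \<in> A" and "x \<in> (\<Union>d. L d)"
    then obtain d where "x \<in> L d" by auto
    then have "s x \<in> L d" by (rule submod_app[OF L s])
    then show "s x \<in> (\<Union>d. L d)" by blast
  qed
  moreover have "(\<Union>d. L d) \<subseteq> X"
    by (auto simp: L_def)
  ultimately obtain S where S: "finite S" "(\<Union>d. L d) = gen A S"
    using noethE[OF noeth] by blast
  then have "S \<subseteq> (\<Union>d. L d)"
    using gen_superset by blast
  with S(1) have "\<exists>D. S \<subseteq> L D"
  proof (induction S rule: finite_induct)
    case (insert x F)
    then obtain D where "F \<subseteq> L D" by auto
    moreover obtain d where "x \<in> L d" using insert by auto
    ultimately have "insert x F \<subseteq> L (max d D)"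
      using Lmono[of d "max d D"] Lmono[of D "max d D"] by auto
    then show ?case by blast
  qed auto
  then obtain D where D: "S \<subseteq> L D" by blast
  have LD: "L d \<subseteq> L D" for d
    using gen_minimal[OF L D] S(2) by blast
  have LX: "L d \<subseteq> X" for d
    by (auto simp: L_def)
  have "\<exists>S. finite S \<and> L d = gen A S" for d
    by (rule noethE[OF noeth LX L[of d]]) blast
  then obtain T where T: "\<And>d. finite (T d)" "\<And>d. L d = gen A (T d)"
    by metis
  \<comment> \<open>\<open>n d x\<close> is an element of \<open>N\<close> with leading term t^d x.
    Only the degrees up to \<open>D\<close> contribute to the generating set
    \<open>G\<close>.\<close>
  define n where "n d x = (SOME m. m \<in> N \<and> m - (t ^^ d) x \<in> ?Y d)" for d x
  have "\<exists>m. m \<in> N \<and> m - (t ^^ d) x \<in> ?Y d" if "x \<in> T d" for d x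
  proof -
    have "x \<in> L d" using that T(2) gen_superset by blast
    then show ?thesis by (auto simp: L_def)
  qed
  then have n: "n d x \<in> N" "n d x - (t ^^ d) x \<in> ?Y d" if "x \<in> T d" for d x
    using that unfolding n_def by (metis (no_types, lifting) someI_ex)+
  define G where "G = (\<Union>d\<in>{..D}. n d ` T d)"
  let ?M = "gen (insert t A) G"
  have GN: "?M \<subseteq> N"
    by (rule gen_minimal[OF N]) (auto simp: G_def n)
  have M: "submod (insert t A) ?M"
    by (rule submod_gen)
  \<comment> \<open>Every coefficient in \<open>L d\<close> is a combination of elements of
    \<open>T d\<close> over \<open>A\<close>; the same combination of the chosen
    \<open>n d x\<close> realises it inside \<open>?M\<close>.\<close>
  have lift: "\<exists>m\<in>?M. m - (t ^^ d) x \<in> ?Y d" if "x \<in> L d" "d \<le> D" for d x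
    using that(1) unfolding T(2)
  proof (induction rule: gen.induct)
    case (base x)
    then have "n d x \<in> ?M"
      using that(2) by (auto simp: G_def intro!: gen.base)
    then show ?case using n(2)[OF base] by blast
  next
    case zero
    then show ?case
      using submod_zero[OF Y[of d]] by (auto simp: additive.zero[OF tadd] intro!: bexI[of _ 0] gen.zero)
  next
    case (diff x y)
    then obtain m m' where *: "m \<in> ?M" "m' \<in> ?M" "m - (t ^^ d) x \<in> ?Y d" "m' - (t ^^ d) y \<in> ?Y d"
      by auto
    have "(m - m') - (t ^^ d) (x - y) = (m - (t ^^ d) x) - (m' - (t ^^ d) y)"
      by (simp add: additive.diff[OF tadd])
    then have "(m - m') - (t ^^ d) (x - y) \<in> ?Y d"
      using submod_diff[OF Y *(3,4)] by (simp only:)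
    then show ?case
      using submod_diff[OF M *(1,2)] by blast
  next
    case (app s x)
    then obtain m where *: "m \<in> ?M" "m - (t ^^ d) x \<in> ?Y d"
      by auto
    have "s m - (t ^^ d) (s x) = s (m - (t ^^ d) x)"
      using comm[OF app(1)] by (simp add: additive.diff[OF A[OF app(1)]] funpow_commute)
    then have "s m - (t ^^ d) (s x) \<in> ?Y d"
      using submod_app[OF Y app(1) *(2)] by (simp only:)
    then show ?case
      using submod_app[OF M _ *(1), of s] app(1) by blast
  qed
  \<comment> \<open>Above degree \<open>D\<close> there are no new leading coefficients: realise
    \<open>x\<close> in degree \<open>D\<close> and multiply by t^(d - D).\<close>
  have lift': "\<exists>m\<in>?M. m - (t ^^ d) x \<in> ?Y d" if x: "x \<in> L d" for d x
  proof (cases "d \<le> D")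
    case True
    then show ?thesis using lift x by blast
  next
    case False
    have *: "\<exists>m\<in>?M. m - (t ^^ (D + k)) x \<in> ?Y (D + k)" for k
    proof (induction k)
      case 0
      then show ?case using lift[of x D] LD x by auto
    next
      case (Suc k)
      then obtain m where m: "m \<in> ?M" "m - (t ^^ (D + k)) x \<in> ?Y (D + k)" by auto
      have "t m - (t ^^ (D + Suc k)) x = t (m - (t ^^ (D + k)) x)"
        by (simp add: additive.diff[OF t])
      then have "t m - (t ^^ (D + Suc k)) x \<in> ?Y (D + Suc k)"
        using degree_filtration_app[OF t submod_zero[OF X] m(2)] by (simp only: add_Suc_right)
      then show ?case using submod_app[OF M _ m(1), of t] by blast
    qed
    show ?thesis using *[of "d - D"] False by simp
  qed
  \<comment> \<open>Subtracting an element of \<open>?M\<close> with the same leading term leaves an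
    element of \<open>N\<close> one level lower in the filtration.\<close>
  have "x \<in> ?M" if "x \<in> N" "x \<in> ?Y d" for d x
    using that
  proof (induction d arbitrary: x)
    case 0
    then show ?case using gen.zero by simp
  next
    case (Suc d)
    then obtain u v where *: "x = u + (t ^^ d) v" "v \<in> X" "u \<in> ?Y d"
      by auto
    have "x - (t ^^ d) v \<in> ?Y d"
      using * by simp
    then have "v \<in> L d"
      using *(2) Suc.prems(1) unfolding L_def by blast
    then obtain m where m: "m \<in> ?M" "m - (t ^^ d) v \<in> ?Y d"
      using lift' by blast
    have "x - m = u - (m - (t ^^ d) v)"
      by (simp add: *)
    then have "x - m \<in> ?Y d"
      using submod_diff[OF Y *(3) m(2)] by (simp only:)
    moreover have "x - m \<in> N"
      using submod_diff[OF N] Suc.prems m(1) GN by blast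
    ultimately have "(x - m) + m \<in> ?M"
      using Suc.IH m(1) by (blast intro: submod_add[OF M])
    then show ?case by simp
  qed
  then have "N \<subseteq> ?M"
    using NX gen_subset_degree_filtration[OF A t comm X] by blast
  moreover have "finite G"
    using T(1) by (auto simp: G_def)
  ultimately show "\<exists>S. finite S \<and> N = gen (insert t A) S"
    using GN by blast
qed

text \<open>The step from polynomials to Laurent polynomials. Some power of \<open>t\<close> carries
  any given element into the polynomial part \<open>?P\<close>, and powers of \<open>t'\<close>
  carry it back, so a submodule stable under \<open>t\<close> and \<open>t'\<close> is generated by
  its intersection with \<open>?P\<close>, to which \<open>noeth_insert\<close> applies.\<close>

proposition noeth_insert_inverse:
  assumes A: "\<And>s. s \<in> A \<Longrightarrow> Modules.additive s" and t: "Modules.additive t"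
    and comm: "\<And>s x. s \<in> A \<Longrightarrow> s (t x) = t (s x)"
    and inv: "\<And>x. t (t' x) = x" "\<And>x. t' (t x) = x"
    and X: "submod A X" and noeth: "noeth A X"
  shows "noeth (insert t (insert t' A)) (gen (insert t (insert t' A)) X)"
  unfolding noeth_def
proof (intro allI impI)
  let ?A = "insert t (insert t' A)" and ?P = "gen (insert t A) X"
  fix N assume NX: "N \<subseteq> gen ?A X" and N: "submod ?A N"
  have P: "submod (insert t A) ?P"
    by (rule submod_gen)
  have "submod (insert t A) (N \<inter> ?P)"
    by (intro submod_Int P submod_mono[OF N]) auto
  then obtain G where G: "finite G" "N \<inter> ?P = gen (insert t A) G"
    using noethE[OF noeth_insert[OF A t comm X noeth] Int_lower2] by blast
  have GN: "gen ?A G \<subseteq> N"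
    using G(2) gen_superset[of G "insert t A"] by (intro gen_minimal[OF N]) blast
  have pw: "(t ^^ (e + k)) x \<in> ?P" if "(t ^^ e) x \<in> ?P" for e k x
    using submod_funpow[OF P _ that, of t k] by (simp add: funpow_add add.commute[of e])
  have "gen ?A X \<subseteq> {x. \<exists>e. (t ^^ e) x \<in> ?P}"
  proof (rule gen_minimal)
    show "submod ?A {x. \<exists>e. (t ^^ e) x \<in> ?P}"
    proof (rule submodI)
      show "0 \<in> {x. \<exists>e. (t ^^ e) x \<in> ?P}"
        by (auto intro!: exI[of _ 0] gen.zero)
    next
      fix x y assume "x \<in> {x. \<exists>e. (t ^^ e) x \<in> ?P}" "y \<in> {x. \<exists>e. (t ^^ e) x \<in> ?P}"
      then obtain d e where "(t ^^ d) x \<in> ?P" "(t ^^ e) y \<in> ?P" by auto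
      then have "(t ^^ (d + e)) x \<in> ?P" "(t ^^ (d + e)) y \<in> ?P"
        using pw[of d x e] pw[of e y d] by (simp_all add: add.commute)
      then have "(t ^^ (d + e)) (x - y) \<in> ?P"
        using submod_diff[OF P] by (simp add: additive.diff[OF additive_funpow[OF t]])
      then show "x - y \<in> {x. \<exists>e. (t ^^ e) x \<in> ?P}" by blast
    next
      fix s x assume "s \<in> ?A" and "x \<in> {x. \<exists>e. (t ^^ e) x \<in> ?P}"
      then obtain e where e: "(t ^^ e) x \<in> ?P" by auto
      consider "s = t" | "s = t'" | "s \<in> A" using \<open>s \<in> ?A\<close> by auto
      then show "s x \<in> {x. \<exists>e. (t ^^ e) x \<in> ?P}"
      proof cases
        case 1
        then have "(t ^^ e) (s x) \<in> ?P"
          using pw[OF e, of 1] by (simp add: funpow_swap1)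
        then show ?thesis by blast
      next
        case 2
        then have "(t ^^ Suc e) (s x) \<in> ?P"
          using e by (simp add: funpow_swap1 inv)
        then show ?thesis by blast
      next
        case 3
        then have "(t ^^ e) (s x) = s ((t ^^ e) x)"
          using comm[OF 3] by (simp add: funpow_commute)
        then have "(t ^^ e) (s x) \<in> ?P"
          using submod_app[OF P _ e, of s] 3 by auto
        then show ?thesis by blast
      qed
    qed
    show "X \<subseteq> {x. \<exists>e. (t ^^ e) x \<in> ?P}"
      by (auto intro!: exI[of _ 0] gen.base)
  qed
  then have "\<exists>e. (t ^^ e) x \<in> N \<inter> ?P" if "x \<in> N" for x
    using that NX submod_funpow[OF N _ that, of t] by blast
  moreover have "(t' ^^ e) ((t ^^ e) x) = x" for e x
    by (induction e arbitrary: x) (simp_all add: funpow_swap1 inv)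
  moreover have "(t' ^^ e) y \<in> gen ?A G" if "y \<in> gen (insert t A) G" for e y
    using submod_funpow[OF submod_gen, of t' ?A y G e] gen_mono[of "insert t A" ?A G G] that by auto
  ultimately have "N \<subseteq> gen ?A G"
    unfolding G(2) by (intro subsetI) metis
  then show "\<exists>S. finite S \<and> N = gen ?A S"
    using G(1) GN by blast
qed

section \<open>Finitely generated abelian groups\<close>

definition zmul :: "int \<Rightarrow> 'm::ab_group_add \<Rightarrow> 'm" where
  "zmul n x = (if n \<ge> 0 then (\<Sum>i<nat n. x) else - (\<Sum>i<nat (- n). x))"

lemma zmul_0 [simp]: "zmul 0 x = 0" and zmul_1 [simp]: "zmul 1 x = x"
  by (simp_all add: zmul_def)

lemma zmul_plus1: "zmul (n + 1) x = zmul n x + x"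
proof (cases "n \<ge> 0")
  case True
  then show ?thesis by (simp add: zmul_def nat_add_distrib)
next
  case False
  then have "nat (- n) = Suc (nat (- n - 1))" by simp
  then show ?thesis using False by (auto simp: zmul_def)
qed

lemma additive_zmul: "Modules.additive (\<lambda>n. zmul n x)"
proof
  fix m n
  have *: "zmul (k - 1) x = zmul k x - x" for k
    using zmul_plus1[of "k - 1" x] by (simp add: algebra_simps)
  show "zmul (m + n) x = zmul m x + zmul n x"
  proof (induction n rule: int_induct[where k = 0])
    case (step1 i)
    then show ?case by (simp add: zmul_plus1 add.assoc[symmetric])
  next
    case (step2 i)
    then show ?case using *[of "m + i"] *[of i] by (simp add: add_diff_eq)
  qed simp
qed

lemma additive_zmul_commute: "Modules.additive f \<Longrightarrow> f (zmul n x) = zmul n (f x)"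
  by (simp add: zmul_def additive.sum additive.minus)

lemma submod_zmul: "submod A N \<Longrightarrow> x \<in> N \<Longrightarrow> zmul n x \<in> N"
  by (simp add: zmul_def submod_sum submod_uminus)

lemma int_subgroup_principal:
  assumes "submod {} (I :: int set)"
  obtains d where "d \<in> I" "\<And>k. k \<in> I \<Longrightarrow> d dvd k"
proof (cases "\<exists>k\<in>I. k \<noteq> 0")
  case False
  then show thesis using that[of 0] submod_zero[OF assms] by auto
next
  case True
  then obtain k where k: "k \<in> I" "k \<noteq> 0" by auto
  then have "\<bar>k\<bar> \<in> I" using submod_uminus[OF assms] by (auto simp: abs_if)
  then have ex: "\<exists>n::nat. n > 0 \<and> int n \<in> I"
    using k by (intro exI[of _ "nat \<bar>k\<bar>"]) auto
  define d where "d = (LEAST n::nat. n > 0 \<and> int n \<in> I)"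
  have d: "d > 0" "int d \<in> I"
    using LeastI_ex[OF ex] by (auto simp: d_def)
  have "int d dvd k" if "k \<in> I" for k
  proof (rule ccontr)
    assume "\<not> int d dvd k"
    then have pos: "k mod int d > 0"
      using d by (metis dvd_eq_mod_eq_0 of_nat_0_less_iff order_le_less pos_mod_sign)
    have "zmul (k div int d) (int d) = (k div int d) * int d"
      by (auto simp: zmul_def)
    then have "k mod int d \<in> I"
      using submod_diff[OF assms that submod_zmul[OF assms d(2), of "k div int d"]]
      by (simp add: minus_div_mult_eq_mod)
    then have "d \<le> nat (k mod int d)"
      unfolding d_def using pos by (intro Least_le) (auto simp: d_def)
    moreover have "k mod int d < int d" using d by simp
    ultimately show False using pos by linarith
  qed
  then show thesis using d(2) that by blast
qed

text \<open>Base case without operators, by induction on the generators. The integers occurring as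
  coefficient of the new generator \<open>u\<close> in elements of \<open>N\<close> form a subgroup
  dZ. One element of \<open>N\<close> with coefficient \<open>d\<close>, together with generators of
  the part of \<open>N\<close> inside the old group, generates \<open>N\<close>.\<close>

lemma noeth_finite_gen: "finite S \<Longrightarrow> noeth {} (gen {} S)"
proof (induction S rule: finite_induct)
  case empty
  have "gen {} {} \<subseteq> {0::'a}"
    by (rule gen_minimal) (auto simp: submod_def)
  then have "N = gen {} {}" if "N \<subseteq> gen {} {}" "submod {} N" for N :: "'a set"
    using that by (auto dest: submod_zero gen.cases)
  then show ?case unfolding noeth_def by blast
next
  case (insert u S)
  let ?X = "gen {} S"
  have X: "submod {} ?X" by (rule submod_gen)
  note zm = additive.diff[OF additive_zmul] additive.zero[OF additive_zmul]
  show ?case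
    unfolding noeth_def
  proof (intro allI impI)
    fix N assume NX: "N \<subseteq> gen {} (insert u S)" and N: "submod {} N"
    have "gen {} (insert u S) \<subseteq> {x. \<exists>k. x - zmul k u \<in> ?X}"
    proof (rule gen_minimal)
      show "submod {} {x. \<exists>k. x - zmul k u \<in> ?X}"
      proof (rule submodI)
        show "0 \<in> {x. \<exists>k. x - zmul k u \<in> ?X}"
          by (auto intro!: exI[of _ 0] gen.zero)
        fix x y assume "x \<in> {x. \<exists>k. x - zmul k u \<in> ?X}" "y \<in> {x. \<exists>k. x - zmul k u \<in> ?X}"
        then obtain k l where "x - zmul k u \<in> ?X" "y - zmul l u \<in> ?X" by auto
        moreover have "(x - y) - zmul (k - l) u = (x - zmul k u) - (y - zmul l u)"
          by (simp add: zm)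
        ultimately have "(x - y) - zmul (k - l) u \<in> ?X"
          using submod_diff[OF X] by (simp only:)
        then show "x - y \<in> {x. \<exists>k. x - zmul k u \<in> ?X}" by blast
      qed auto
      have "u - zmul 1 u \<in> ?X" by (simp add: gen.zero)
      moreover have "x - zmul 0 u \<in> ?X" if "x \<in> S" for x
        using that by (simp add: gen.base)
      ultimately show "insert u S \<subseteq> {x. \<exists>k. x - zmul k u \<in> ?X}" by blast
    qed
    then have coeff: "\<exists>k. n - zmul k u \<in> ?X" if "n \<in> N" for n
      using that NX by blast
    define I where "I = {k. \<exists>n\<in>N. n - zmul k u \<in> ?X}"
    have "submod {} I"
    proof (rule submodI)
      show "0 \<in> I"
        using submod_zero[OF N] by (auto simp: I_def intro!: bexI[of _ 0] gen.zero)
      fix k l assume "k \<in> I" "l \<in> I"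
      then obtain n m where *: "n \<in> N" "m \<in> N" "n - zmul k u \<in> ?X" "m - zmul l u \<in> ?X"
        by (auto simp: I_def)
      have "(n - m) - zmul (k - l) u = (n - zmul k u) - (m - zmul l u)"
        by (simp add: zm)
      then have "(n - m) - zmul (k - l) u \<in> ?X"
        using submod_diff[OF X *(3,4)] by (simp only:)
      then show "k - l \<in> I"
        using submod_diff[OF N *(1,2)] unfolding I_def by blast
    qed auto
    then obtain d where d: "d \<in> I" "\<And>k. k \<in> I \<Longrightarrow> d dvd k"
      by (rule int_subgroup_principal) blast
    then obtain n where n: "n \<in> N" "n - zmul d u \<in> ?X"
      by (auto simp: I_def)
    obtain T where T: "finite T" "N \<inter> ?X = gen {} T"
      using noethE[OF insert.IH Int_lower2 submod_Int[OF N X]] by blast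
    have TN: "gen {} (insert n T) \<subseteq> N"
      by (rule gen_minimal[OF N]) (use n(1) T(2) gen_superset[of T "{}"] in auto)
    have "N \<subseteq> gen {} (insert n T)"
    proof
      fix x assume x: "x \<in> N"
      then obtain k where k: "x - zmul k u \<in> ?X" using coeff by blast
      then have "k \<in> I"
        unfolding I_def using x by blast
      from d(2)[OF this] obtain q where "k = d * q"
        by (rule dvdE)
      then have q: "k = q * d"
        by (simp only: mult.commute)
      have add: "Modules.additive (zmul q :: 'a \<Rightarrow> 'a)"
        by standard (simp add: zmul_def sum.distrib)
      have "zmul k u = zmul q (zmul d u)"
      proof -
        \<comment> \<open>Associativity of integer multiples results from applying
          \<open>additive_zmul_commute\<close> to this map at \<open>zmul q 1 = q\<close>.\<close>
        have "Modules.additive (\<lambda>j. zmul (j * d) u)"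
          by standard (simp add: distrib_right additive.add[OF additive_zmul])
        then have "zmul (zmul q 1 * d) u = zmul q (zmul (1 * d) u)"
          by (rule additive_zmul_commute)
        moreover have "zmul q 1 = q" by (simp add: zmul_def)
        ultimately show ?thesis by (simp add: q)
      qed
      then have "x - zmul q n = (x - zmul k u) - zmul q (n - zmul d u)"
        by (simp add: additive.diff[OF add])
      then have "x - zmul q n \<in> ?X"
        using submod_diff[OF X k submod_zmul[OF X n(2)]] by (simp only:)
      moreover have "x - zmul q n \<in> N"
        using submod_diff[OF N x submod_zmul[OF N n(1)]] .
      ultimately have "x - zmul q n \<in> gen {} (insert n T)"
        using T(2) gen_mono[of "{}" "{}" T "insert n T"] by blast
      moreover have "zmul q n \<in> gen {} (insert n T)"
        by (intro submod_zmul[OF submod_gen] gen.base) auto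
      ultimately have "(x - zmul q n) + zmul q n \<in> gen {} (insert n T)"
        by (rule submod_add[OF submod_gen])
      then show "x \<in> gen {} (insert n T)" by simp
    qed
    then show "\<exists>S. finite S \<and> N = gen {} S"
      using TN T(1) by blast
  qed
qed

section \<open>Modules over a finitely generated abelian group\<close>

locale gmodule =
  fixes act :: "'v::ab_group_add \<Rightarrow> 'm::ab_group_add \<Rightarrow> 'm"
  assumes act_0 [simp]: "act 0 m = m"
    and act_act: "act g (act h m) = act (g + h) m"
    and act_add: "act g (m + m') = act g m + act g m'"
begin

lemma additive_act: "Modules.additive (act g)"
  by standard (rule act_add)

text \<open>Each group generator \<open>b\<close> contributes the invertible operator
  \<open>act b\<close>, so \<open>noeth_insert_inverse\<close> adds one generator at a time; the
  operators commute because the group is abelian.\<close>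

lemma noeth_finite_action:
  assumes "finite B" "finite S"
  shows "noeth (act ` (B \<union> uminus ` B)) (gen (act ` (B \<union> uminus ` B)) S)"
  using assms(1)
proof (induction B rule: finite_induct)
  case empty
  show ?case using noeth_finite_gen[OF assms(2)] by simp
next
  case (insert b B)
  let ?A = "act ` (B \<union> uminus ` B)"
  have eq: "act ` (insert b B \<union> uminus ` insert b B) = insert (act b) (insert (act (- b)) ?A)"
    by auto
  have "noeth (insert (act b) (insert (act (- b)) ?A))
          (gen (insert (act b) (insert (act (- b)) ?A)) (gen ?A S))"
  proof (rule noeth_insert_inverse)
    show "s (act b x) = act b (s x)" if "s \<in> ?A" for s x
      using that by (auto simp: act_act add.commute)
  qed (use insert.IH additive_act submod_gen in \<open>auto simp: act_act\<close>)
  moreover have "gen (insert (act b) (insert (act (- b)) ?A)) (gen ?A S) =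
      gen (insert (act b) (insert (act (- b)) ?A)) S"
    by (rule gen_gen) auto
  ultimately show ?case unfolding eq by simp
qed

text \<open>The elements \<open>g\<close> for which both \<open>g\<close> and \<open>- g\<close>
  preserve \<open>N\<close> form a subgroup; asking for both makes the condition stable under
  differences.\<close>

lemma submod_act_gen:
  assumes "submod (act ` (B \<union> uminus ` B)) N"
  shows "submod (act ` gen {} B) N"
proof -
  have "gen {} B \<subseteq> {g. \<forall>x\<in>N. act g x \<in> N \<and> act (- g) x \<in> N}"
  proof (rule gen_minimal)
    show "submod {} {g. \<forall>x\<in>N. act g x \<in> N \<and> act (- g) x \<in> N}"
    proof (rule submodI)
      fix g h assume *: "g \<in> {g. \<forall>x\<in>N. act g x \<in> N \<and> act (- g) x \<in> N}"
        "h \<in> {g. \<forall>x\<in>N. act g x \<in> N \<and> act (- g) x \<in> N}"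
      have "act (g - h) x = act g (act (- h) x)" "act (- (g - h)) x = act h (act (- g) x)" for x
        by (simp_all add: act_act)
      then show "g - h \<in> {g. \<forall>x\<in>N. act g x \<in> N \<and> act (- g) x \<in> N}"
        using * by simp
    qed auto
    show "B \<subseteq> {g. \<forall>x\<in>N. act g x \<in> N \<and> act (- g) x \<in> N}"
      using submod_app[OF assms] by auto
  qed
  then show ?thesis
    using assms by (auto simp: submod_def)
qed

theorem noeth_action:
  assumes "finite B" "finite S"
  shows "noeth (act ` gen {} B) (gen (act ` gen {} B) S)"
proof -
  let ?A = "act ` (B \<union> uminus ` B)" and ?A' = "act ` gen {} B"
  have sub: "B \<union> uminus ` B \<subseteq> gen {} B"
    using submod_uminus[OF submod_gen[of "{}" B]] gen_superset[of B "{}"] by auto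
  have eq: "gen ?A T = gen ?A' T" for T
  proof
    show "gen ?A T \<subseteq> gen ?A' T"
      by (rule gen_mono) (use sub in auto)
    show "gen ?A' T \<subseteq> gen ?A T"
      by (rule gen_minimal) (auto intro: submod_act_gen submod_gen gen.base)
  qed
  have "submod ?A N" if "submod ?A' N" for N
    by (rule submod_mono[OF that]) (use sub in auto)
  then show ?thesis
    using noeth_finite_action[OF assms] unfolding noeth_def eq by blast
qed

end

section \<open>The bar complex\<close>

definition lin_ext :: "('k \<Rightarrow> 'm \<Rightarrow> 'n) \<Rightarrow> ('k \<Rightarrow>\<^sub>0 'm::ab_group_add) \<Rightarrow> 'n::ab_group_add" where
  "lin_ext f c = (\<Sum>k\<in>Poly_Mapping.keys c. f k (poly_mapping.lookup c k))"

lemma additive_lin_ext: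
  assumes "\<And>k. Modules.additive (f k)"
  shows "Modules.additive (lin_ext f)"
  by standard
     (auto simp: lin_ext_def additive.zero[OF assms] additive.add[OF assms] intro!: setsum_keys_plus_distrib)

lemma lin_ext_single: "f k 0 = 0 \<Longrightarrow> lin_ext f (Poly_Mapping.single k m) = f k m"
  by (simp add: lin_ext_def)

lemma sum_single_lookup: "(\<Sum>k\<in>Poly_Mapping.keys c. Poly_Mapping.single k (poly_mapping.lookup c k)) = c"
proof (rule poly_mapping_eqI)
  fix k
  show "poly_mapping.lookup (\<Sum>k\<in>Poly_Mapping.keys c. Poly_Mapping.single k (poly_mapping.lookup c k)) k = poly_mapping.lookup c k"
    by (simp add: lookup_sum lookup_single when_def in_keys_iff)
qed

text \<open>The standard way to prove identities of chains below. Only keys of \<open>c\<close> have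
  to be tested, which lets a restriction on the support of \<open>c\<close> enter the
  comparison.\<close>

lemma additive_eq_on_singles:
  fixes c :: "'k \<Rightarrow>\<^sub>0 'm::ab_group_add"
  assumes "Modules.additive u" "Modules.additive v"
    and "\<And>k m. k \<in> Poly_Mapping.keys c \<Longrightarrow> u (Poly_Mapping.single k m) = v (Poly_Mapping.single k m)"
  shows "u c = v c"
proof -
  have "u (\<Sum>k\<in>Poly_Mapping.keys c. Poly_Mapping.single k (poly_mapping.lookup c k)) =
      v (\<Sum>k\<in>Poly_Mapping.keys c. Poly_Mapping.single k (poly_mapping.lookup c k))"
    by (simp add: additive.sum[OF assms(1)] additive.sum[OF assms(2)] assms(3))
  then show ?thesis by (simp add: sum_single_lookup)
qed

lemma additive_single: "Modules.additive (Poly_Mapping.single k)"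
  by standard (simp add: single_add)

lemma additive_compose: "Modules.additive u \<Longrightarrow> Modules.additive v \<Longrightarrow> Modules.additive (\<lambda>x. u (v x))"
  by (simp add: Modules.additive_def)

lemma additive_plus: "Modules.additive u \<Longrightarrow> Modules.additive v \<Longrightarrow> Modules.additive (\<lambda>x. u x + v x)"
  by (simp add: Modules.additive_def algebra_simps)

lemma additive_id: "Modules.additive (\<lambda>x. x)"
  by (simp add: Modules.additive_def)

lemma additive_const_0: "Modules.additive (\<lambda>x. 0)"
  by (simp add: Modules.additive_def)

lemma additive_sum: "(\<And>i. i \<in> I \<Longrightarrow> Modules.additive (f i)) \<Longrightarrow> Modules.additive (\<lambda>x. \<Sum>i\<in>I. f i x)"
  by (auto simp: Modules.additive_def sum.distrib[symmetric] intro: sum.cong)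

lemma lin_ext_in_submod:
  assumes "submod A N" "\<And>k. k \<in> Poly_Mapping.keys c \<Longrightarrow> f k (poly_mapping.lookup c k) \<in> N"
  shows "lin_ext f c \<in> N"
  unfolding lin_ext_def by (rule submod_sum[OF assms(1)]) (rule assms(2))

section \<open>Bar chains with coefficients in a submodule\<close>

definition bar_coeff :: "('v \<Rightarrow> 'm \<Rightarrow> 'm) \<Rightarrow> nat \<Rightarrow> 'v list \<Rightarrow> 'm \<Rightarrow> 'm::ab_group_add" where
  "bar_coeff act i gs m = (if i = 0 then act (hd gs) m else if even i then m else - m)"

text \<open>The empty list has no faces in the bar complex, so its boundary is set to 0; this makes
  every 0-chain a cycle.\<close>

definition bar_term ::
    "('v \<Rightarrow> 'm \<Rightarrow> 'm) \<Rightarrow> 'v::euclidean_space list \<Rightarrow> 'm \<Rightarrow> 'v list \<Rightarrow>\<^sub>0 'm::ab_group_add" where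
  "bar_term act gs m =
     (if gs = [] then 0
      else \<Sum>i\<le>length gs. Poly_Mapping.single (dface i gs) (bar_coeff act i gs m))"

definition bar_bd ::
    "('v \<Rightarrow> 'm \<Rightarrow> 'm) \<Rightarrow> ('v::euclidean_space list \<Rightarrow>\<^sub>0 'm) \<Rightarrow> 'v list \<Rightarrow>\<^sub>0 'm::ab_group_add" where
  "bar_bd act = lin_ext (bar_term act)"

definition bar_chains :: "'v set \<Rightarrow> 'm set \<Rightarrow> nat \<Rightarrow> ('v list \<Rightarrow>\<^sub>0 'm::ab_group_add) set" where
  "bar_chains \<Gamma> N p =
     {c. \<forall>gs\<in>Poly_Mapping.keys c. length gs = p \<and> set gs \<subseteq> \<Gamma> \<and> poly_mapping.lookup c gs \<in> N}"

definition bar_cycles ::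
    "('v \<Rightarrow> 'm \<Rightarrow> 'm) \<Rightarrow> 'v::euclidean_space set \<Rightarrow> 'm set \<Rightarrow> nat \<Rightarrow> ('v list \<Rightarrow>\<^sub>0 'm::ab_group_add) set" where
  "bar_cycles act \<Gamma> N p = {z \<in> bar_chains \<Gamma> N p. bar_bd act z = 0}"

text \<open>Finite generation over Z of the homology group, phrased with cycles and boundaries so
  that no quotient has to be formed.\<close>

definition bar_homology_fg ::
    "('v \<Rightarrow> 'm \<Rightarrow> 'm) \<Rightarrow> 'v::euclidean_space set \<Rightarrow> 'm::ab_group_add set \<Rightarrow> nat \<Rightarrow> bool" where
  "bar_homology_fg act \<Gamma> N p \<longleftrightarrow>
     (\<exists>S. finite S \<and> S \<subseteq> bar_cycles act \<Gamma> N p \<and>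
        bar_cycles act \<Gamma> N p \<subseteq> gen {} (S \<union> bar_bd act ` bar_chains \<Gamma> N (Suc p)))"

lemma submod_bar_chains:
  assumes N: "submod A N"
  shows "submod {} (bar_chains \<Gamma> N p)"
proof (rule submodI)
  fix c d assume *: "c \<in> bar_chains \<Gamma> N p" "d \<in> bar_chains \<Gamma> N p"
  have mem: "poly_mapping.lookup c gs \<in> N" "poly_mapping.lookup d gs \<in> N" for gs
    using * submod_zero[OF N]
    by (cases "gs \<in> Poly_Mapping.keys c"; cases "gs \<in> Poly_Mapping.keys d";
        auto simp: bar_chains_def in_keys_iff)+
  have "gs \<in> Poly_Mapping.keys c \<or> gs \<in> Poly_Mapping.keys d"
    if "gs \<in> Poly_Mapping.keys (c - d)" for gs
    using that by (auto simp: in_keys_iff lookup_minus)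
  then show "c - d \<in> bar_chains \<Gamma> N p"
    using * mem submod_diff[OF N] by (fastforce simp: bar_chains_def lookup_minus)
qed (auto simp: bar_chains_def)

lemma single_in_bar_chains:
  "length gs = p \<Longrightarrow> set gs \<subseteq> \<Gamma> \<Longrightarrow> m \<in> N \<Longrightarrow> Poly_Mapping.single gs m \<in> bar_chains \<Gamma> N p"
  by (auto simp: bar_chains_def)

section \<open>Simplicial identities of the faces\<close>

lemma length_dface: "gs \<noteq> [] \<Longrightarrow> i \<le> length gs \<Longrightarrow> length (dface i gs) = length gs - 1"
  by (auto simp: dface_def)

text \<open>One formula for the entries covers the first, inner and last faces alike, so the
  simplicial identities become case distinctions on positions.\<close>

lemma nth_dface:
  assumes "i \<le> length gs" "Suc k < length gs"
  shows "dface i gs ! k =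
    (if Suc k < i then gs ! k else if Suc k = i then gs ! k + gs ! Suc k else gs ! Suc k)"
proof -
  consider "i = 0" | "0 < i" "i < length gs" | "0 < i" "i = length gs"
    using assms by linarith
  then show ?thesis
  proof cases
    case 1
    then show ?thesis using assms by (simp add: dface_def nth_tl)
  next
    case 2
    then show ?thesis
      using assms by (cases "k < i") (auto simp: dface_def nth_append min_def nth_Cons')
  next
    case 3
    then show ?thesis using assms by (auto simp: dface_def nth_butlast)
  qed
qed

lemma set_dface:
  assumes \<Gamma>: "submod {} \<Gamma>" and "gs \<noteq> []" "i \<le> length gs" "set gs \<subseteq> \<Gamma>"
  shows "set (dface i gs) \<subseteq> \<Gamma>"
proof
  fix g assume "g \<in> set (dface i gs)"
  then obtain k where k: "k < length gs - 1" "g = dface i gs ! k"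
    using assms by (auto simp: in_set_conv_nth length_dface)
  then have "gs ! k \<in> \<Gamma>" "gs ! Suc k \<in> \<Gamma>"
    using assms(4) by (auto intro!: subsetD[OF assms(4)])
  then show "g \<in> \<Gamma>"
    using k assms submod_add[OF \<Gamma>, of "gs ! k" "gs ! Suc k"] by (auto simp: nth_dface)
qed

text \<open>Comparison entry by entry. For \<open>j = i + 1\<close> three neighbouring entries may
  be merged, and there associativity of addition is needed.\<close>

lemma dface_dface:
  assumes "i < j" "j \<le> length gs" "2 \<le> length gs"
  shows "dface i (dface j gs) = dface (j - 1) (dface i gs)"
proof -
  have ne: "gs \<noteq> []" using assms by auto
  have len: "length (dface j gs) = length gs - 1" "length (dface i gs) = length gs - 1"
    using length_dface[OF ne] assms by auto
  have ne': "dface j gs \<noteq> []" "dface i gs \<noteq> []"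
    using len assms by auto
  show ?thesis
  proof (rule nth_equalityI)
    show "length (dface i (dface j gs)) = length (dface (j - 1) (dface i gs))"
      using assms len by (simp add: length_dface[OF ne'(1)] length_dface[OF ne'(2)])
    fix k assume "k < length (dface i (dface j gs))"
    then have k: "Suc (Suc k) < length gs"
      using assms len by (simp add: length_dface[OF ne'(1)])
    have "i \<le> length (dface j gs)" "j - 1 \<le> length (dface i gs)" "i \<le> length gs"
      using assms len by auto
    then show "dface i (dface j gs) ! k = dface (j - 1) (dface i gs) ! k"
      using assms k len by (auto simp: nth_dface add.assoc)
  qed
qed

lemma hd_dface:
  assumes "2 \<le> length gs" "i \<le> length gs"
  shows "hd (dface i gs) = (if i = 0 then gs ! 1 else if i = 1 then gs ! 0 + gs ! 1 else gs ! 0)"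
proof -
  have "length (dface i gs) = length gs - 1"
    using assms by (intro length_dface) auto
  then have "dface i gs \<noteq> []"
    using assms by auto
  then show ?thesis
    using assms nth_dface[of i gs 0] by (auto simp: hd_conv_nth)
qed

text \<open>The cancellation behind d d = 0. The pairs with \<open>i < j\<close> correspond to the
  remaining ones by sending \<open>(j, i)\<close> to \<open>(i, j - 1)\<close>, and corresponding
  terms are opposite.\<close>

lemma sum_simplicial_cancel:
  fixes t :: "nat \<Rightarrow> nat \<Rightarrow> 'a::ab_group_add"
  assumes "\<And>i j. i < j \<Longrightarrow> j \<le> Suc n \<Longrightarrow> t i j = - t (j - 1) i"
  shows "(\<Sum>j\<le>Suc n. \<Sum>i\<le>n. t i j) = 0"
proof -
  let ?A = "{(j, i). j \<le> Suc n \<and> i < j}" and ?B = "{(j, i). j \<le> i \<and> i \<le> n}"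
  have fin: "finite ?A" "finite ?B"
    by (rule finite_subset[of _ "{..Suc n} \<times> {..Suc n}"]; auto)+
  have "(\<Sum>j\<le>Suc n. \<Sum>i\<le>n. t i j) = (\<Sum>(j, i)\<in>{..Suc n} \<times> {..n}. t i j)"
    by (simp add: sum.cartesian_product)
  also have "{..Suc n} \<times> {..n} = ?A \<union> ?B"
    by auto
  also have "(\<Sum>(j, i)\<in>?A \<union> ?B. t i j) = (\<Sum>(j, i)\<in>?A. t i j) + (\<Sum>(j, i)\<in>?B. t i j)"
    by (rule sum.union_disjoint[OF fin]) auto
  also have "(\<Sum>(j, i)\<in>?A. t i j) = (\<Sum>(j, i)\<in>?B. - t i j)"
    by (rule sum.reindex_bij_witness[of _ "\<lambda>(j, i). (Suc i, j)" "\<lambda>(j, i). (i, j - 1)"])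
       (auto simp: assms)
  also have "\<dots> + (\<Sum>(j, i)\<in>?B. t i j) = 0"
    by (simp add: split_def sum_negf)
  finally show ?thesis .
qed

locale bar = gmodule act for act :: "'v::euclidean_space \<Rightarrow> 'm::ab_group_add \<Rightarrow> 'm"
begin

lemma additive_bar_coeff: "Modules.additive (bar_coeff act i gs)"
  by standard (simp add: bar_coeff_def act_add)

lemma additive_bar_term: "Modules.additive (bar_term act gs)"
  unfolding bar_term_def
  by (cases "gs = []")
     (auto intro!: additive_sum additive_compose[OF additive_single] additive_bar_coeff additive_const_0)

lemma additive_bar_bd: "Modules.additive (bar_bd act)"
  unfolding bar_bd_def by (rule additive_lin_ext) (rule additive_bar_term)

lemma bar_bd_single: "bar_bd act (Poly_Mapping.single gs m) = bar_term act gs m"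
  unfolding bar_bd_def by (rule lin_ext_single) (rule additive.zero[OF additive_bar_term])

lemma bar_term_in_chains:
  assumes "submod {} \<Gamma>" and N: "submod (act ` \<Gamma>) N"
    and "length gs = Suc p" "set gs \<subseteq> \<Gamma>" "m \<in> N"
  shows "bar_term act gs m \<in> bar_chains \<Gamma> N p"
proof -
  have ne: "gs \<noteq> []" using assms by auto
  then have "hd gs \<in> \<Gamma>" using assms(4) by auto
  then have "bar_coeff act i gs m \<in> N" for i
    using submod_app[OF N] submod_uminus[OF N] assms by (auto simp: bar_coeff_def)
  then have "Poly_Mapping.single (dface i gs) (bar_coeff act i gs m) \<in> bar_chains \<Gamma> N p"
    if "i \<le> length gs" for i
    using that assms ne set_dface[OF assms(1) ne that] by (intro single_in_bar_chains) (auto simp: length_dface)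
  then show ?thesis
    unfolding bar_term_def using ne by (auto intro: submod_sum[OF submod_bar_chains[OF N]])
qed

lemma bar_bd_in_chains:
  assumes "submod {} \<Gamma>" and N: "submod (act ` \<Gamma>) N" and "c \<in> bar_chains \<Gamma> N (Suc p)"
  shows "bar_bd act c \<in> bar_chains \<Gamma> N p"
  unfolding bar_bd_def
proof (rule lin_ext_in_submod[OF submod_bar_chains[OF N]])
  fix gs assume "gs \<in> Poly_Mapping.keys c"
  then show "bar_term act gs (poly_mapping.lookup c gs) \<in> bar_chains \<Gamma> N p"
    using assms(3) by (intro bar_term_in_chains[OF assms(1) N]) (auto simp: bar_chains_def)
qed

lemma bar_bd_0_chain: "c \<in> bar_chains \<Gamma> N 0 \<Longrightarrow> bar_bd act c = 0"
  by (auto simp: bar_bd_def lin_ext_def bar_chains_def bar_term_def intro!: sum.neutral)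

lemma bar_bd_bd: "bar_bd act (bar_bd act c) = 0"
proof (rule additive_eq_on_singles[where u = "\<lambda>c. bar_bd act (bar_bd act c)" and v = "\<lambda>c. 0"])
  fix gs :: "'v list" and m :: 'm
  show "bar_bd act (bar_bd act (Poly_Mapping.single gs m)) = 0"
  proof (cases "length gs \<ge> 2")
    case True
    define n where "n = length gs - 1"
    have len: "length gs = Suc n" and ne: "gs \<noteq> []"
      using True by (auto simp: n_def)
    define t where "t i j = Poly_Mapping.single (dface i (dface j gs))
        (bar_coeff act i (dface j gs) (bar_coeff act j gs m))" for i j
    have "bar_bd act (bar_bd act (Poly_Mapping.single gs m)) =
        (\<Sum>j\<le>Suc n. bar_term act (dface j gs) (bar_coeff act j gs m))"
      by (simp add: bar_bd_single bar_term_def[of _ gs] ne len additive.sum[OF additive_bar_bd]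
          del: sum.atMost_Suc)
    also have "\<dots> = (\<Sum>j\<le>Suc n. \<Sum>i\<le>n. t i j)"
    proof (rule sum.cong)
      fix j assume "j \<in> {..Suc n}"
      then have "length (dface j gs) = n"
        using length_dface[OF ne, of j] len by auto
      moreover from this have "dface j gs \<noteq> []"
        using True len by auto
      ultimately show "bar_term act (dface j gs) (bar_coeff act j gs m) = (\<Sum>i\<le>n. t i j)"
        by (simp add: bar_term_def t_def)
    qed auto
    also have "\<dots> = 0"
    proof (rule sum_simplicial_cancel)
      fix i j assume ij: "i < j" "j \<le> Suc n"
      \<comment> \<open>For \<open>i = 0\<close> and \<open>j = 1\<close>, acting by the sum of the
        first two entries is compared with acting by them one after the other. In the other cases
        only the signs have to be matched.\<close>
      have "bar_coeff act i (dface j gs) (bar_coeff act j gs m) =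
          - bar_coeff act (j - 1) (dface i gs) (bar_coeff act i gs m)"
        using ij True len ne
        by (cases "j = 1")
           (auto simp: bar_coeff_def hd_dface additive.minus[OF additive_act] act_act hd_conv_nth add.commute)
      then show "t i j = - t (j - 1) i"
        using dface_dface[of i j gs] ij True len by (simp add: t_def single_uminus)
    qed
    finally show ?thesis .
  next
    case False
    then have "dface i gs = []" if "i \<le> length gs" for i
      using that by (cases gs; cases "tl gs"; auto simp: dface_def)
    then show ?thesis
      by (auto simp: bar_bd_single bar_term_def additive.sum[OF additive_bar_bd]
          additive.zero[OF additive_bar_bd] intro!: sum.neutral)
  qed
qed (auto intro: additive_compose additive_bar_bd additive_const_0)

text \<open>Homology in degree 0 is the group of coinvariants: the boundary of m[g] is gm - m, so
  modulo boundaries the module generators already generate as an abelian group.\<close>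

lemma bar_homology_fg_0:
  assumes \<Gamma>: "submod {} \<Gamma>" and N: "submod (act ` \<Gamma>) N" and S: "finite S" "N = gen (act ` \<Gamma>) S"
  shows "bar_homology_fg act \<Gamma> N 0"
  unfolding bar_homology_fg_def
proof (intro exI conjI)
  let ?S = "Poly_Mapping.single [] ` S" and ?bd = "bar_bd act ` bar_chains \<Gamma> N (Suc 0)"
  show "finite ?S" using S by auto
  have "S \<subseteq> N" using S gen_superset by auto
  then have "?S \<subseteq> bar_chains \<Gamma> N 0"
    by (auto intro: single_in_bar_chains)
  then show "?S \<subseteq> bar_cycles act \<Gamma> N 0"
    by (auto simp: bar_cycles_def bar_bd_0_chain)
  have gen: "submod {} (gen {} (?S \<union> ?bd))"
    by (rule submod_gen)
  have "gen (act ` \<Gamma>) S \<subseteq> {m \<in> N. Poly_Mapping.single [] m \<in> gen {} (?S \<union> ?bd)}"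
  proof (rule gen_minimal)
    show "submod (act ` \<Gamma>) {m \<in> N. Poly_Mapping.single [] m \<in> gen {} (?S \<union> ?bd)}"
    proof (rule submodI)
      fix t m assume "t \<in> act ` \<Gamma>" and m: "m \<in> {m \<in> N. Poly_Mapping.single [] m \<in> gen {} (?S \<union> ?bd)}"
      then obtain g where g: "g \<in> \<Gamma>" "t = act g" by auto
      have "bar_bd act (Poly_Mapping.single [g] m) = Poly_Mapping.single [] (t m) - Poly_Mapping.single [] m"
        by (simp add: bar_bd_single bar_term_def dface_def bar_coeff_def g single_uminus)
      moreover have "bar_bd act (Poly_Mapping.single [g] m) \<in> gen {} (?S \<union> ?bd)"
        using g m by (intro gen.base UnI2 imageI single_in_bar_chains) auto
      ultimately have "(Poly_Mapping.single [] (t m) - Poly_Mapping.single [] m) + Poly_Mapping.single [] m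
          \<in> gen {} (?S \<union> ?bd)"
        using m by (intro submod_add[OF gen]) auto
      then show "t m \<in> {m \<in> N. Poly_Mapping.single [] m \<in> gen {} (?S \<union> ?bd)}"
        using m g submod_app[OF N] by auto
    qed (use submod_zero[OF N] submod_diff[OF N] submod_zero[OF gen] submod_diff[OF gen]
         in \<open>auto simp: single_diff\<close>)
    show "S \<subseteq> {m \<in> N. Poly_Mapping.single [] m \<in> gen {} (?S \<union> ?bd)}"
      using \<open>S \<subseteq> N\<close> by (auto intro: gen.base)
  qed
  then have single: "Poly_Mapping.single [] m \<in> gen {} (?S \<union> ?bd)" if "m \<in> N" for m
    using that S by auto
  show "bar_cycles act \<Gamma> N 0 \<subseteq> gen {} (?S \<union> ?bd)"
  proof
    fix z assume "z \<in> bar_cycles act \<Gamma> N 0"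
    then have z: "z \<in> bar_chains \<Gamma> N 0" by (auto simp: bar_cycles_def)
    have "(\<Sum>k\<in>Poly_Mapping.keys z. Poly_Mapping.single k (poly_mapping.lookup z k)) \<in> gen {} (?S \<union> ?bd)"
    proof (rule submod_sum[OF gen])
      fix gs assume "gs \<in> Poly_Mapping.keys z"
      then have "gs = []" "poly_mapping.lookup z gs \<in> N"
        using z by (auto simp: bar_chains_def)
      then show "Poly_Mapping.single gs (poly_mapping.lookup z gs) \<in> gen {} (?S \<union> ?bd)"
        using single by simp
    qed
    then show "z \<in> gen {} (?S \<union> ?bd)"
      by (simp add: sum_single_lookup)
  qed
qed

end

subsection \<open>Free modules\<close>

text \<open>The pair \<open>(j, h)\<close> stands for h times the j-th basis vector. Thus
  \<open>free_mod k \<Gamma>\<close> is the free Z[\<Gamma>]-module of rank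
  \<open>k\<close>.\<close>

definition free_act :: "'v \<Rightarrow> (nat \<times> 'v::ab_group_add \<Rightarrow>\<^sub>0 int) \<Rightarrow> nat \<times> 'v \<Rightarrow>\<^sub>0 int" where
  "free_act g = lin_ext (\<lambda>(j, h) n. Poly_Mapping.single (j, g + h) n)"

definition free_mod :: "nat \<Rightarrow> 'v set \<Rightarrow> (nat \<times> 'v \<Rightarrow>\<^sub>0 int) set" where
  "free_mod k \<Gamma> = {c. Poly_Mapping.keys c \<subseteq> {..<k} \<times> \<Gamma>}"

lemma additive_free_act: "Modules.additive (free_act g)"
  unfolding free_act_def by (rule additive_lin_ext) (auto intro: additive_single)

lemma free_act_single: "free_act g (Poly_Mapping.single (j, h) n) = Poly_Mapping.single (j, g + h) n"
  unfolding free_act_def by (subst lin_ext_single) auto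

interpretation free: bar "free_act :: 'v::euclidean_space \<Rightarrow> _"
proof
  fix m :: "nat \<times> 'v \<Rightarrow>\<^sub>0 int"
  show "free_act 0 m = m"
    by (rule additive_eq_on_singles[OF additive_free_act additive_id]) (auto simp: free_act_single)
  fix g h :: 'v
  show "free_act g (free_act h m) = free_act (g + h) m"
    by (rule additive_eq_on_singles[OF additive_compose[OF additive_free_act additive_free_act] additive_free_act])
       (auto simp: free_act_single add.assoc)
qed (rule additive.add[OF additive_free_act])

lemma submod_free_mod:
  assumes "submod {} \<Gamma>"
  shows "submod (free_act ` \<Gamma>) (free_mod k \<Gamma>)"
proof (rule submodI)
  have grp: "submod {} (free_mod k \<Gamma>)"
  proof (rule submodI)
    fix c d assume "c \<in> free_mod k \<Gamma>" "d \<in> free_mod k \<Gamma>"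
    then show "c - d \<in> free_mod k \<Gamma>"
      using keys_diff[of c d] by (auto simp: free_mod_def)
  qed (auto simp: free_mod_def)
  then show "0 \<in> free_mod k \<Gamma>" and "\<And>c d. c \<in> free_mod k \<Gamma> \<Longrightarrow> d \<in> free_mod k \<Gamma> \<Longrightarrow> c - d \<in> free_mod k \<Gamma>"
    by (auto dest: submod_zero submod_diff)
  fix t c assume "t \<in> free_act ` \<Gamma>" and c: "c \<in> free_mod k \<Gamma>"
  then obtain g where g: "g \<in> \<Gamma>" "t = free_act g" by auto
  show "t c \<in> free_mod k \<Gamma>"
    unfolding g(2) free_act_def
    by (rule lin_ext_in_submod[OF grp])
       (use c g submod_add[OF assms] in \<open>fastforce simp: free_mod_def\<close>)
qed

lemma free_mod_subset_gen:
  assumes "submod {} \<Gamma>"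
  shows "free_mod k \<Gamma> \<subseteq> gen (free_act ` \<Gamma>) ((\<lambda>j. Poly_Mapping.single (j, 0::'v::euclidean_space) 1) ` {..<k})"
proof
  let ?G = "gen (free_act ` \<Gamma>) ((\<lambda>j. Poly_Mapping.single (j, 0::'v) 1) ` {..<k})"
  fix c assume "c \<in> free_mod k \<Gamma>"
  then have "Poly_Mapping.keys c \<subseteq> {..<k} \<times> \<Gamma>"
    by (simp add: free_mod_def)
  then show "c \<in> ?G"
  proof (induction c rule: frag_induction)
    case (one x)
    then obtain j h where x: "x = (j, h)" "j < k" "h \<in> \<Gamma>" by auto
    then have "Poly_Mapping.single (j, 0::'v) 1 \<in> ?G"
      by (intro gen.base) auto
    then have "free_act h (Poly_Mapping.single (j, 0) 1) \<in> ?G"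
      by (rule submod_app[OF submod_gen imageI[OF x(3)]])
    then show ?case by (simp add: free_act_single x)
  qed (auto intro: gen.zero gen.diff)
qed

section \<open>Contracting homotopy for free coefficients\<close>

text \<open>The group element \<open>h\<close> in a coefficient h e_j is moved into a new first slot
  of the list; face 0 of the result moves it back.\<close>

definition bar_homotopy ::
    "('v list \<Rightarrow>\<^sub>0 (nat \<times> 'v::euclidean_space \<Rightarrow>\<^sub>0 int)) \<Rightarrow> 'v list \<Rightarrow>\<^sub>0 (nat \<times> 'v \<Rightarrow>\<^sub>0 int)" where
  "bar_homotopy =
     lin_ext (\<lambda>gs. lin_ext (\<lambda>(j, h) n. Poly_Mapping.single (h # gs) (Poly_Mapping.single (j, 0) n)))"

lemma additive_bar_homotopy_term:
  "Modules.additive (lin_ext (\<lambda>(j, h) n. Poly_Mapping.single (h # gs) (Poly_Mapping.single (j, 0::'v::zero) (n::int))))"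
  by (rule additive_lin_ext) (auto intro: additive_compose[OF additive_single additive_single])

lemma additive_bar_homotopy: "Modules.additive bar_homotopy"
  unfolding bar_homotopy_def by (rule additive_lin_ext) (rule additive_bar_homotopy_term)

lemma bar_homotopy_single:
  "bar_homotopy (Poly_Mapping.single gs (Poly_Mapping.single (j, h) n)) =
     Poly_Mapping.single (h # gs) (Poly_Mapping.single (j, 0) n)"
  unfolding bar_homotopy_def
  by (subst lin_ext_single) (auto simp: lin_ext_single additive.zero[OF additive_bar_homotopy_term])

lemma bar_homotopy_in_chains:
  assumes \<Gamma>: "submod {} \<Gamma>" and c: "c \<in> bar_chains \<Gamma> (free_mod k \<Gamma>) p"
  shows "bar_homotopy c \<in> bar_chains \<Gamma> (free_mod k \<Gamma>) (Suc p)"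
  unfolding bar_homotopy_def
proof (intro lin_ext_in_submod[OF submod_bar_chains[OF submod_free_mod[OF \<Gamma>]]])
  fix gs k' assume gs: "gs \<in> Poly_Mapping.keys c" and k': "k' \<in> Poly_Mapping.keys (poly_mapping.lookup c gs)"
  obtain j h where jh: "k' = (j, h)" by fastforce
  have "length gs = p" "set gs \<subseteq> \<Gamma>" "poly_mapping.lookup c gs \<in> free_mod k \<Gamma>"
    using c gs by (auto simp: bar_chains_def)
  then show "(case k' of (j, h) \<Rightarrow> \<lambda>n. Poly_Mapping.single (h # gs) (Poly_Mapping.single (j, 0) n))
        (poly_mapping.lookup (poly_mapping.lookup c gs) k') \<in> bar_chains \<Gamma> (free_mod k \<Gamma>) (Suc p)"
    using k' submod_zero[OF \<Gamma>] unfolding jh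
    by (auto intro!: single_in_bar_chains simp: free_mod_def split: if_splits)
qed

text \<open>The identity d s + s d = 1 for the homotopy s. It fails on the empty list, where d s
  sends h e_j to h e_j - e_j, in accordance with the nonzero coinvariants of a free module.\<close>

lemma bar_homotopy:
  assumes "[] \<notin> Poly_Mapping.keys c"
  shows "bar_bd free_act (bar_homotopy c) + bar_homotopy (bar_bd free_act c) = c"
proof (rule additive_eq_on_singles[where v = "\<lambda>c. c"
      and u = "\<lambda>c. bar_bd free_act (bar_homotopy c) + bar_homotopy (bar_bd free_act c)"])
  note bd = free.additive_bar_bd and s = additive_bar_homotopy
  show add: "Modules.additive (\<lambda>c. bar_bd free_act (bar_homotopy c) + bar_homotopy (bar_bd free_act c))"
    by (intro additive_plus additive_compose[OF bd s] additive_compose[OF s bd])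
  fix gs :: "'a list" and m :: "nat \<times> 'a \<Rightarrow>\<^sub>0 int"
  assume "gs \<in> Poly_Mapping.keys c"
  then have ne: "gs \<noteq> []" using assms by auto
  show "bar_bd free_act (bar_homotopy (Poly_Mapping.single gs m)) +
      bar_homotopy (bar_bd free_act (Poly_Mapping.single gs m)) = Poly_Mapping.single gs m"
  proof (rule additive_eq_on_singles[where u = "\<lambda>m. bar_bd free_act (bar_homotopy (Poly_Mapping.single gs m)) +
      bar_homotopy (bar_bd free_act (Poly_Mapping.single gs m))"])
    show "Modules.additive (\<lambda>m. bar_bd free_act (bar_homotopy (Poly_Mapping.single gs m)) +
      bar_homotopy (bar_bd free_act (Poly_Mapping.single gs m)))"
      by (rule additive_compose[OF add additive_single])
    show "Modules.additive (Poly_Mapping.single gs)"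
      by (rule additive_single)
    fix jh :: "nat \<times> 'a" and n :: int
    obtain j h where jh: "jh = (j, h)" by fastforce
    define e where "e = Poly_Mapping.single (j, 0::'a) n"
    have "bar_bd free_act (bar_homotopy (Poly_Mapping.single gs (Poly_Mapping.single (j, h) n))) =
        bar_term free_act (h # gs) e"
      by (simp add: bar_homotopy_single free.bar_bd_single e_def)
    also have "\<dots> = Poly_Mapping.single gs (Poly_Mapping.single (j, h) n) +
        (\<Sum>i\<le>length gs. Poly_Mapping.single (dface (Suc i) (h # gs)) (bar_coeff free_act (Suc i) (h # gs) e))"
      by (simp add: bar_term_def sum.atMost_Suc_shift bar_coeff_def dface_def e_def free_act_single
          del: sum.atMost_Suc)
    finally have 1: "bar_bd free_act (bar_homotopy (Poly_Mapping.single gs (Poly_Mapping.single (j, h) n))) =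
       Poly_Mapping.single gs (Poly_Mapping.single (j, h) n) +
        (\<Sum>i\<le>length gs. Poly_Mapping.single (dface (Suc i) (h # gs)) (bar_coeff free_act (Suc i) (h # gs) e))" .
    have "bar_homotopy (bar_bd free_act (Poly_Mapping.single gs (Poly_Mapping.single (j, h) n))) =
       (\<Sum>i\<le>length gs. bar_homotopy (Poly_Mapping.single (dface i gs)
          (bar_coeff free_act i gs (Poly_Mapping.single (j, h) n))))"
      by (simp add: free.bar_bd_single bar_term_def ne additive.sum[OF s])
    also have "\<dots> = (\<Sum>i\<le>length gs. - Poly_Mapping.single (dface (Suc i) (h # gs))
          (bar_coeff free_act (Suc i) (h # gs) e))"
    proof (rule sum.cong)
      fix i assume "i \<in> {..length gs}"
      show "bar_homotopy (Poly_Mapping.single (dface i gs) (bar_coeff free_act i gs (Poly_Mapping.single (j, h) n))) =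
        - Poly_Mapping.single (dface (Suc i) (h # gs)) (bar_coeff free_act (Suc i) (h # gs) e)"
      \<comment> \<open>Face \<open>i\<close> of \<open>gs\<close> matches face \<open>Suc i\<close>
        of \<open>h # gs\<close> with the opposite sign. For \<open>i = 0\<close> the action of
        \<open>hd gs\<close> on the coefficient turns \<open>h\<close> into
        \<open>hd gs + h\<close>, which is the entry obtained by merging the first two
        slots.\<close>
      proof (cases i)
        case 0
        then show ?thesis using ne
          by (cases gs)
             (auto simp: bar_coeff_def dface_def free_act_single bar_homotopy_single e_def single_uminus add.commute)
      next
        case (Suc i')
        have "dface (Suc i) (h # gs) = h # dface i gs"
          using Suc ne by (auto simp: dface_def)
        then show ?thesis using Suc
          by (auto simp: bar_coeff_def bar_homotopy_single e_def single_uminus additive.minus[OF s])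
      qed
    qed auto
    finally show "bar_bd free_act (bar_homotopy (Poly_Mapping.single gs (Poly_Mapping.single jh n))) +
      bar_homotopy (bar_bd free_act (Poly_Mapping.single gs (Poly_Mapping.single jh n))) =
      Poly_Mapping.single gs (Poly_Mapping.single jh n)"
      unfolding jh 1 by (simp add: sum_negf)
  qed
qed (rule additive_id)

lemma free_acyclic:
  assumes "submod {} \<Gamma>" and "z \<in> bar_cycles free_act \<Gamma> (free_mod k \<Gamma>) (Suc p)"
  obtains w where "w \<in> bar_chains \<Gamma> (free_mod k \<Gamma>) (Suc (Suc p))" "z = bar_bd free_act w"
proof
  have z: "z \<in> bar_chains \<Gamma> (free_mod k \<Gamma>) (Suc p)" "bar_bd free_act z = 0"
    using assms(2) by (auto simp: bar_cycles_def)
  show "bar_homotopy z \<in> bar_chains \<Gamma> (free_mod k \<Gamma>) (Suc (Suc p))"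
    by (rule bar_homotopy_in_chains[OF assms(1) z(1)])
  have "[] \<notin> Poly_Mapping.keys z"
    using z(1) by (auto simp: bar_chains_def)
  from bar_homotopy[OF this] show "z = bar_bd free_act (bar_homotopy z)"
    by (simp add: z(2) additive.zero[OF additive_bar_homotopy])
qed

subsection \<open>Dimension shifting\<close>

definition chain_map :: "('m \<Rightarrow> 'n) \<Rightarrow> ('k \<Rightarrow>\<^sub>0 'm::ab_group_add) \<Rightarrow> 'k \<Rightarrow>\<^sub>0 'n::ab_group_add" where
  "chain_map \<phi> = lin_ext (\<lambda>k m. Poly_Mapping.single k (\<phi> m))"

lemma additive_chain_map: "Modules.additive \<phi> \<Longrightarrow> Modules.additive (chain_map \<phi>)"
  unfolding chain_map_def by (intro additive_lin_ext additive_compose[OF additive_single])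

lemma chain_map_single:
  "Modules.additive \<phi> \<Longrightarrow> chain_map \<phi> (Poly_Mapping.single k m) = Poly_Mapping.single k (\<phi> m)"
  unfolding chain_map_def by (subst lin_ext_single) (auto simp: additive.zero)

lemma lookup_chain_map:
  assumes "Modules.additive \<phi>"
  shows "poly_mapping.lookup (chain_map \<phi> c) k = \<phi> (poly_mapping.lookup c k)"
  using additive.zero[OF assms]
  by (simp add: chain_map_def lin_ext_def lookup_sum lookup_single when_def in_keys_iff)

lemma chain_map_in_chains:
  assumes "Modules.additive \<phi>" "c \<in> bar_chains \<Gamma> M p" "\<And>m. m \<in> M \<Longrightarrow> \<phi> m \<in> N"
  shows "chain_map \<phi> c \<in> bar_chains \<Gamma> N p"
proof -
  have "gs \<in> Poly_Mapping.keys c" if "gs \<in> Poly_Mapping.keys (chain_map \<phi> c)" for gs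
    using that additive.zero[OF assms(1)] by (auto simp: in_keys_iff lookup_chain_map[OF assms(1)])
  then show ?thesis
    using assms(2,3) by (auto simp: bar_chains_def lookup_chain_map[OF assms(1)])
qed

lemma chain_map_bar_bd:
  assumes "bar act" "bar act'" and \<phi>: "Modules.additive \<phi>" "\<And>g m. \<phi> (act g m) = act' g (\<phi> m)"
  shows "chain_map \<phi> (bar_bd act c) = bar_bd act' (chain_map \<phi> c)"
proof -
  interpret A: bar act by fact
  interpret B: bar act' by fact
  note cm = additive_chain_map[OF \<phi>(1)]
  have coeff: "\<phi> (bar_coeff act i gs m) = bar_coeff act' i gs (\<phi> m)" for i gs m
    by (simp add: bar_coeff_def \<phi>(2) additive.minus[OF \<phi>(1)])
  show ?thesis
    by (rule additive_eq_on_singles[OF additive_compose[OF cm A.additive_bar_bd]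
          additive_compose[OF B.additive_bar_bd cm]])
       (simp add: A.bar_bd_single B.bar_bd_single chain_map_single[OF \<phi>(1)] bar_term_def
          additive.zero[OF cm] additive.sum[OF cm] coeff)
qed

section \<open>Free covers and the connecting homomorphism\<close>

context bar
begin

definition free_cover :: "(nat \<Rightarrow> 'm) \<Rightarrow> (nat \<times> 'v \<Rightarrow>\<^sub>0 int) \<Rightarrow> 'm" where
  "free_cover m = lin_ext (\<lambda>(j, h) n. zmul n (act h (m j)))"

lemma additive_free_cover: "Modules.additive (free_cover m)"
  unfolding free_cover_def by (rule additive_lin_ext) (auto intro: additive_zmul)

lemma free_cover_single: "free_cover m (Poly_Mapping.single (j, h) n) = zmul n (act h (m j))"
  unfolding free_cover_def by (subst lin_ext_single) auto

lemma free_cover_act: "free_cover m (free_act g c) = act g (free_cover m c)"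
  by (rule additive_eq_on_singles[OF additive_compose[OF additive_free_cover additive_free_act]
        additive_compose[OF additive_act additive_free_cover]])
     (auto simp: free_act_single free_cover_single additive_zmul_commute[OF additive_act] act_act)

lemma free_cover_in:
  assumes N: "submod (act ` \<Gamma>) N" and "\<And>j. j < k \<Longrightarrow> m j \<in> N" "c \<in> free_mod k \<Gamma>"
  shows "free_cover m c \<in> N"
  unfolding free_cover_def
proof (rule lin_ext_in_submod[OF N])
  fix x assume "x \<in> Poly_Mapping.keys c"
  then obtain j h where "x = (j, h)" "j < k" "h \<in> \<Gamma>"
    using assms(3) by (auto simp: free_mod_def)
  then show "(case x of (j, h) \<Rightarrow> \<lambda>n. zmul n (act h (m j))) (poly_mapping.lookup c x) \<in> N"
    using assms(2) submod_zmul[OF N] submod_app[OF N] by auto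
qed

lemma free_cover_surj:
  assumes \<Gamma>: "submod {} \<Gamma>"
  shows "gen (act ` \<Gamma>) (m ` {..<k}) \<subseteq> free_cover m ` free_mod k \<Gamma>"
proof (rule gen_minimal)
  note F = submod_free_mod[OF \<Gamma>, of k]
  show "submod (act ` \<Gamma>) (free_cover m ` free_mod k \<Gamma>)"
  proof (rule submodI)
    show "0 \<in> free_cover m ` free_mod k \<Gamma>"
      using submod_zero[OF F] additive.zero[OF additive_free_cover] by (metis image_eqI)
    show "x - y \<in> free_cover m ` free_mod k \<Gamma>"
      if "x \<in> free_cover m ` free_mod k \<Gamma>" "y \<in> free_cover m ` free_mod k \<Gamma>" for x y
      using that submod_diff[OF F] additive.diff[OF additive_free_cover] by (auto simp: image_iff) metis
    show "t x \<in> free_cover m ` free_mod k \<Gamma>"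
      if t: "t \<in> act ` \<Gamma>" and x: "x \<in> free_cover m ` free_mod k \<Gamma>" for t x
    proof -
      obtain g where g: "g \<in> \<Gamma>" "t = act g" using t by auto
      obtain c where c: "c \<in> free_mod k \<Gamma>" "x = free_cover m c" using x by auto
      have "free_act g c \<in> free_mod k \<Gamma>"
        using submod_app[OF F imageI[OF g(1)] c(1)] .
      then show ?thesis
        using g c by (auto simp: free_cover_act[symmetric])
    qed
  qed
  show "m ` {..<k} \<subseteq> free_cover m ` free_mod k \<Gamma>"
  proof
    fix x assume "x \<in> m ` {..<k}"
    then obtain j where "j < k" "x = m j" by auto
    then show "x \<in> free_cover m ` free_mod k \<Gamma>"
      using submod_zero[OF \<Gamma>]
      by (intro image_eqI[of _ _ "Poly_Mapping.single (j, 0) 1"]) (auto simp: free_cover_single free_mod_def)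
  qed
qed

text \<open>The connecting homomorphism of \<open>0 \<rightarrow> K \<rightarrow> F \<rightarrow> N \<rightarrow> 0\<close> embeds the homology of \<open>N\<close>
  in degree \<open>p + 1\<close> into that of \<open>K\<close> in degree \<open>p\<close>, as \<open>F\<close> is acyclic.\<close>
proposition bar_homology_fg_Suc:
  fixes m :: "nat \<Rightarrow> 'm"
  assumes \<Gamma>: "submod {} \<Gamma>" and N: "N = gen (act ` \<Gamma>) (m ` {..<k})"
    and K: "bar_homology_fg free_act \<Gamma> {c \<in> free_mod k \<Gamma>. free_cover m c = 0} p"
  shows "bar_homology_fg act \<Gamma> N (Suc p)"
proof -
  let ?F = "free_mod k \<Gamma>" and ?\<pi> = "free_cover m" and ?d = "bar_bd free_act"
  let ?K = "{c \<in> ?F. ?\<pi> c = 0}"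
  let ?\<Pi> = "chain_map ?\<pi>"
  have N': "submod (act ` \<Gamma>) N"
    unfolding N by (rule submod_gen)
  note F = submod_free_mod[OF \<Gamma>, of k]
  note \<pi> = additive_free_cover[of m]
  have barF: "bar (free_act :: 'v \<Rightarrow> _)" by (rule free.bar_axioms)
  have bar: "bar act" by (rule bar_axioms)
  note \<Pi> = additive_chain_map[OF \<pi>]
  note \<Pi>d = chain_map_bar_bd[where \<phi> = "free_cover m", OF barF bar \<pi> free_cover_act]
  have mN: "m j \<in> N" if "j < k" for j
    unfolding N using that by (auto intro: gen.base)
  have \<pi>N: "?\<pi> c \<in> N" if "c \<in> ?F" for c
    by (rule free_cover_in[OF N' mN that])
  have KF: "bar_chains \<Gamma> ?K q \<subseteq> bar_chains \<Gamma> ?F q" for q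
    by (auto simp: bar_chains_def)
  have \<Pi>K: "?\<Pi> c = 0" if "c \<in> bar_chains \<Gamma> ?K q" for c q
  proof (rule poly_mapping_eqI)
    fix gs
    show "poly_mapping.lookup (?\<Pi> c) gs = poly_mapping.lookup 0 gs"
      using that additive.zero[OF \<pi>]
      by (cases "gs \<in> Poly_Mapping.keys c")
         (auto simp: lookup_chain_map[OF \<pi>] bar_chains_def in_keys_iff)
  qed
  note Fch = submod_bar_chains[OF F, of \<Gamma>]
  obtain S where S: "finite S" "S \<subseteq> bar_cycles free_act \<Gamma> ?K p"
    "bar_cycles free_act \<Gamma> ?K p \<subseteq> gen {} (S \<union> ?d ` bar_chains \<Gamma> ?K (Suc p))"
    using K unfolding bar_homology_fg_def by auto
  have dch: "submod {} (?d ` bar_chains \<Gamma> M q)" if "submod A M" for A M q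
  proof -
    have "gen {} (bar_chains \<Gamma> M q) \<subseteq> bar_chains \<Gamma> M q"
      by (rule gen_minimal[OF submod_bar_chains[OF that] order_refl])
    then have "gen {} (bar_chains \<Gamma> M q) = bar_chains \<Gamma> M q"
      using gen_superset by blast
    then have "?d ` bar_chains \<Gamma> M q = gen {} (?d ` bar_chains \<Gamma> M q)"
      using gen_image_additive[OF free.additive_bar_bd, of "bar_chains \<Gamma> M q"] by simp
    then show ?thesis using submod_gen by metis
  qed
  have "submod (free_act ` \<Gamma>) ?K"
  proof (rule submodI)
    fix t c assume "t \<in> free_act ` \<Gamma>" "c \<in> ?K"
    then show "t c \<in> ?K"
      using submod_app[OF F] by (auto simp: free_cover_act additive.zero[OF additive_act])
  qed (use submod_zero[OF F] submod_diff[OF F] in \<open>auto simp: additive.zero[OF \<pi>] additive.diff[OF \<pi>]\<close>)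
  note Ksub = this
  \<comment> \<open>The combinations of \<open>S\<close> that bound in the free module form a
    subgroup of a finitely generated abelian group. Its generators \<open>T\<close> are boundaries
    of chains \<open>U\<close>, and the images of \<open>U\<close> in \<open>N\<close> will generate
    the homology of \<open>N\<close>.\<close>
  obtain T where T: "finite T" "gen {} S \<inter> ?d ` bar_chains \<Gamma> ?F (Suc p) = gen {} T"
    by (rule noethE[OF noeth_finite_gen[OF S(1)] Int_lower1 submod_Int[OF submod_gen dch[OF F]]])
  have TT: "T \<subseteq> gen {} S" "T \<subseteq> ?d ` bar_chains \<Gamma> ?F (Suc p)"
    using T(2) gen_superset[of T "{}"] by blast+
  obtain U where U: "U \<subseteq> bar_chains \<Gamma> ?F (Suc p)" "finite U" "T = ?d ` U"
    using finite_subset_image[OF T(1) TT(2)] by blast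
  have SK: "gen {} S \<subseteq> bar_chains \<Gamma> ?K p"
    by (rule gen_minimal[OF submod_bar_chains[OF Ksub]]) (use S(2) in \<open>auto simp: bar_cycles_def\<close>)
  show ?thesis
    unfolding bar_homology_fg_def
  proof (intro exI conjI)
    show "finite (?\<Pi> ` U)" using U by auto
    show "?\<Pi> ` U \<subseteq> bar_cycles act \<Gamma> N (Suc p)"
    proof
      fix y assume "y \<in> ?\<Pi> ` U"
      then obtain u where u: "u \<in> U" "y = ?\<Pi> u" by auto
      have "?d u \<in> bar_chains \<Gamma> ?K p"
        using u U TT SK by auto
      then have "bar_bd act y = 0"
        using \<Pi>d[of u] \<Pi>K u by auto
      moreover have "y \<in> bar_chains \<Gamma> N (Suc p)"
        using u U \<pi>N by (auto intro!: chain_map_in_chains[OF \<pi>])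
      ultimately show "y \<in> bar_cycles act \<Gamma> N (Suc p)"
        by (simp add: bar_cycles_def)
    qed
    show "bar_cycles act \<Gamma> N (Suc p) \<subseteq> gen {} (?\<Pi> ` U \<union> bar_bd act ` bar_chains \<Gamma> N (Suc (Suc p)))"
    proof
      let ?R = "gen {} (?\<Pi> ` U \<union> bar_bd act ` bar_chains \<Gamma> N (Suc (Suc p)))"
      fix z assume z: "z \<in> bar_cycles act \<Gamma> N (Suc p)"
      have "\<exists>c. c \<in> ?F \<and> ?\<pi> c = x" if "x \<in> N" for x
        using free_cover_surj[OF \<Gamma>, of m k] that unfolding N by auto
      then obtain \<sigma> where \<sigma>: "\<And>x. x \<in> N \<Longrightarrow> \<sigma> x \<in> ?F" "\<And>x. x \<in> N \<Longrightarrow> ?\<pi> (\<sigma> x) = x"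
        by metis
      \<comment> \<open>A lift of \<open>z\<close> along the cover, coefficient by coefficient. The
        section \<sigma> need not be additive, since it is applied only once at each key. The
        boundary of this lift represents the image of \<open>z\<close> under the connecting
        homomorphism.\<close>
      define z' where "z' = (\<Sum>gs\<in>Poly_Mapping.keys z. Poly_Mapping.single gs (\<sigma> (poly_mapping.lookup z gs)))"
      have zk: "length gs = Suc p" "set gs \<subseteq> \<Gamma>" "poly_mapping.lookup z gs \<in> N"
        if "gs \<in> Poly_Mapping.keys z" for gs
        using z that by (auto simp: bar_cycles_def bar_chains_def)
      have z': "z' \<in> bar_chains \<Gamma> ?F (Suc p)"
        unfolding z'_def using zk \<sigma> by (intro submod_sum[OF Fch] single_in_bar_chains) auto
      have \<Pi>z': "?\<Pi> z' = z"
      proof -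
        have "?\<Pi> z' = (\<Sum>gs\<in>Poly_Mapping.keys z. Poly_Mapping.single gs (poly_mapping.lookup z gs))"
          using zk \<sigma> by (simp add: z'_def additive.sum[OF \<Pi>] chain_map_single[OF \<pi>])
        then show ?thesis by (simp add: sum_single_lookup)
      qed
      have "?d z' \<in> bar_chains \<Gamma> ?F p"
        by (rule free.bar_bd_in_chains[OF \<Gamma> F z'])
      moreover have "?\<pi> (poly_mapping.lookup (?d z') gs) = 0" for gs
        using \<Pi>d[of z'] \<Pi>z' z by (simp add: lookup_chain_map[OF \<pi>, symmetric] bar_cycles_def)
      ultimately have "?d z' \<in> bar_cycles free_act \<Gamma> ?K p"
        by (auto simp: bar_cycles_def bar_chains_def free.bar_bd_bd)
      then have "?d z' \<in> gen {} (S \<union> ?d ` bar_chains \<Gamma> ?K (Suc p))"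
        using S(3) by blast
      also have "\<dots> \<subseteq> {x + y | x y. x \<in> gen {} S \<and> y \<in> ?d ` bar_chains \<Gamma> ?K (Suc p)}"
      proof (rule gen_minimal)
        note D = dch[OF Ksub, of "Suc p"]
        note G = submod_gen[of "{}" S]
        show "submod {} {x + y | x y. x \<in> gen {} S \<and> y \<in> ?d ` bar_chains \<Gamma> ?K (Suc p)}"
        proof (rule submodI)
          show "0 \<in> {x + y | x y. x \<in> gen {} S \<and> y \<in> ?d ` bar_chains \<Gamma> ?K (Suc p)}"
            using submod_zero[OF G] submod_zero[OF D] by force
        next
          fix a b assume "a \<in> {x + y | x y. x \<in> gen {} S \<and> y \<in> ?d ` bar_chains \<Gamma> ?K (Suc p)}"
            "b \<in> {x + y | x y. x \<in> gen {} S \<and> y \<in> ?d ` bar_chains \<Gamma> ?K (Suc p)}"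
          then obtain x y x' y' where *: "a = x + y" "b = x' + y'" "x \<in> gen {} S" "x' \<in> gen {} S"
            "y \<in> ?d ` bar_chains \<Gamma> ?K (Suc p)" "y' \<in> ?d ` bar_chains \<Gamma> ?K (Suc p)" by blast
          have "a - b = (x - x') + (y - y')" using * by simp
          then show "a - b \<in> {x + y | x y. x \<in> gen {} S \<and> y \<in> ?d ` bar_chains \<Gamma> ?K (Suc p)}"
            using submod_diff[OF G *(3,4)] submod_diff[OF D *(5,6)] by blast
        qed auto
        have "x + 0 \<in> {x + y | x y. x \<in> gen {} S \<and> y \<in> ?d ` bar_chains \<Gamma> ?K (Suc p)}" if "x \<in> S" for x
          using gen.base[OF that] submod_zero[OF D] by blast
        moreover have "0 + y \<in> {x + y | x y. x \<in> gen {} S \<and> y \<in> ?d ` bar_chains \<Gamma> ?K (Suc p)}"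
          if "y \<in> ?d ` bar_chains \<Gamma> ?K (Suc p)" for y
          using that submod_zero[OF G] by blast
        ultimately show "S \<union> ?d ` bar_chains \<Gamma> ?K (Suc p)
            \<subseteq> {x + y | x y. x \<in> gen {} S \<and> y \<in> ?d ` bar_chains \<Gamma> ?K (Suc p)}"
          by (simp only: add_0_left add_0_right Un_subset_iff) blast
      qed
      finally obtain x w where x: "x \<in> gen {} S" and w: "w \<in> bar_chains \<Gamma> ?K (Suc p)" and
        eq: "?d z' = x + ?d w"
        by auto
      have wF: "w \<in> bar_chains \<Gamma> ?F (Suc p)" using w KF by blast
      \<comment> \<open>So \<open>x\<close> bounds in the free module and is accounted for by
        \<open>T\<close>; a combination \<open>y\<close> of \<open>U\<close> has the same
        boundary.\<close>
      have "x = ?d (z' - w)"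
        using eq by (simp add: additive.diff[OF free.additive_bar_bd])
      then have "x \<in> gen {} T"
        using x submod_diff[OF Fch z' wF] T(2) by blast
      also have "gen {} T = ?d ` gen {} U"
        unfolding U(3) by (rule gen_image_additive[OF free.additive_bar_bd, symmetric])
      finally obtain y where y: "y \<in> gen {} U" "x = ?d y" by blast
      have yF: "y \<in> bar_chains \<Gamma> ?F (Suc p)"
        using y(1) gen_minimal[OF Fch U(1)] by blast
      \<comment> \<open>This difference is a cycle of positive degree with free coefficients, hence
        a boundary. Mapping back to \<open>N\<close> kills \<open>w\<close>, whose coefficients lie
        in the kernel, so \<open>z\<close> becomes the image of \<open>y\<close> plus a
        boundary.\<close>
      have "z' - w - y \<in> bar_chains \<Gamma> ?F (Suc p)"
        by (intro submod_diff[OF Fch] z' wF yF)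
      moreover have "?d (z' - w - y) = 0"
        using eq y(2) by (simp add: additive.diff[OF free.additive_bar_bd])
      ultimately obtain v where v: "v \<in> bar_chains \<Gamma> ?F (Suc (Suc p))" "z' - w - y = ?d v"
        using free_acyclic[OF \<Gamma>, of "z' - w - y" k p] by (auto simp: bar_cycles_def)
      have "z' = ?d v + w + y"
        using v(2) by (simp add: algebra_simps)
      then have "z = bar_bd act (?\<Pi> v) + ?\<Pi> y"
        using \<Pi>z' \<Pi>K[OF w] \<Pi>d[of v] by (simp add: additive.add[OF \<Pi>])
      moreover have "?\<Pi> v \<in> bar_chains \<Gamma> N (Suc (Suc p))"
        using v(1) \<pi>N by (rule chain_map_in_chains[OF \<pi>])
      then have "bar_bd act (?\<Pi> v) \<in> ?R"
        by (intro gen.base) blast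
      moreover have "?\<Pi> y \<in> gen {} (?\<Pi> ` U)"
        using y(1) gen_image_additive[OF \<Pi>, of U] by blast
      then have "?\<Pi> y \<in> ?R"
        using gen_mono[of "{}" "{}" "?\<Pi> ` U" "?\<Pi> ` U \<union> bar_bd act ` bar_chains \<Gamma> N (Suc (Suc p))"] by blast
      ultimately show "z \<in> ?R"
        using submod_add[OF submod_gen] by metis
    qed
  qed
qed

text \<open>The induction hypothesis speaks of \<open>free_act\<close> alone, because the kernel of
  a free cover lies in a free module whatever the coefficients are. That this kernel is finitely
  generated is the Noetherian property of the free module.\<close>

lemma bar_homology_fg_step:
  assumes "finite B" and \<Gamma>: "\<Gamma> = gen {} B" and S: "finite S" "N = gen (act ` \<Gamma>) S"
    and IH: "\<And>S K q. p = Suc q \<Longrightarrow> finite S \<Longrightarrow> K = gen (free_act ` \<Gamma>) S \<Longrightarrow> bar_homology_fg free_act \<Gamma> K q"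
  shows "bar_homology_fg act \<Gamma> N p"
proof (cases p)
  case 0
  show ?thesis
    unfolding 0 using bar_homology_fg_0[of \<Gamma> N S] S submod_gen \<Gamma> by metis
next
  case (Suc q)
  have sub: "submod {} \<Gamma>" unfolding \<Gamma> by (rule submod_gen)
  obtain k and m :: "nat \<Rightarrow> 'm" where m: "S = m ` {..<k}"
    using finite_imp_nat_seg_image_inj_on[OF S(1)] unfolding lessThan_def by metis
  let ?K = "{c \<in> free_mod k \<Gamma>. free_cover m c = 0}"
  note F = submod_free_mod[OF sub, of k]
  have "submod (free_act ` \<Gamma>) ?K"
  proof (rule submodI)
    fix t c assume "t \<in> free_act ` \<Gamma>" "c \<in> ?K"
    then show "t c \<in> ?K"
      using submod_app[OF F] by (auto simp: free_cover_act additive.zero[OF additive_act])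
  qed (use submod_zero[OF F] submod_diff[OF F] in
      \<open>auto simp: additive.zero[OF additive_free_cover] additive.diff[OF additive_free_cover]\<close>)
  moreover have "?K \<subseteq> gen (free_act ` \<Gamma>) ((\<lambda>j. Poly_Mapping.single (j, 0) 1) ` {..<k})"
    using free_mod_subset_gen[OF sub, of k] by blast
  ultimately obtain S' where S': "finite S'" "?K = gen (free_act ` \<Gamma>) S'"
    using noethE[OF free.noeth_action[OF \<open>finite B\<close>, of "(\<lambda>j. Poly_Mapping.single (j, 0) 1) ` {..<k}"]]
    unfolding \<Gamma> by blast
  show ?thesis
    unfolding Suc
    by (rule bar_homology_fg_Suc[OF sub _ IH[OF Suc S'(1) S'(2)]]) (simp add: S(2) m)
qed

end

text \<open>Induction on the degree runs inside the type of free modules, which is closed under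
  passing to kernels; one more step then reaches an arbitrary \<open>act\<close>.\<close>

theorem bar_homology_finitely_generated:
  assumes "bar act" "finite B" "\<Gamma> = gen {} B" "finite S" "N = gen (act ` \<Gamma>) S"
  shows "bar_homology_fg act \<Gamma> N p"
proof -
  have *: "bar_homology_fg free_act \<Gamma> K p" if "finite S" "K = gen (free_act ` \<Gamma>) S" for S K p
    using that
  proof (induction p arbitrary: S K rule: less_induct)
    case (less p)
    show ?case
      by (rule free.bar_homology_fg_step[OF assms(2,3) less.prems]) (use less.IH in blast)
  qed
  show ?thesis
    using bar.bar_homology_fg_step[OF assms] * by blast
qed

subsection \<open>Modules of integer-valued functions\<close>

definition translate :: "'v::euclidean_space \<Rightarrow> ('v \<Rightarrow> int) \<Rightarrow> 'v \<Rightarrow> int" where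
  "translate g \<phi> = (\<lambda>x. \<phi> (x - g))"

interpretation translate: bar translate
  by standard (auto simp: translate_def fun_eq_iff diff_diff_eq add.commute)

lemma sum_fun_apply: "(\<Sum>i\<in>I. f i) x = (\<Sum>i\<in>I. f i x :: 'b::comm_monoid_add)"
  by (induction I rule: infinite_finite_induct) auto

text \<open>\<open>bd\<close> collects all faces equal to a given list, whereas
  \<open>bar_bd\<close> adds up one-term chains. Their agreement transfers results to the concrete
  complex.\<close>

lemma bd_lookup: "bd (poly_mapping.lookup c) = poly_mapping.lookup (bar_bd translate c)"
proof (intro ext)
  fix hs :: "'a list" and x :: 'a
  have coef: "bar_coeff translate i gs m x = dcoef i gs m x" for i gs m
    by (auto simp: bar_coeff_def dcoef_def translate_def)
  have "poly_mapping.lookup (bar_bd translate c) hs x =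
      (\<Sum>gs\<in>Poly_Mapping.keys c. poly_mapping.lookup (bar_term translate gs (poly_mapping.lookup c gs)) hs x)"
    by (simp add: bar_bd_def lin_ext_def lookup_sum sum_fun_apply)
  also have "\<dots> = (\<Sum>gs\<in>Poly_Mapping.keys c. if gs = [] then 0 else
      \<Sum>i\<in>{0..length gs}. if dface i gs = hs then dcoef i gs (poly_mapping.lookup c gs) x else 0)"
    by (intro sum.cong refl)
       (auto simp: bar_term_def lookup_sum sum_fun_apply lookup_single when_def coef atMost_atLeast0 intro!: sum.cong)
  also have "\<dots> = bd (poly_mapping.lookup c) hs x"
    unfolding bd_def
    by (rule sum.mono_neutral_cong_right) (auto simp: in_keys_iff zero_fun_def)
  finally show "bd (poly_mapping.lookup c) hs x = poly_mapping.lookup (bar_bd translate c) hs x" ..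
qed

text \<open>\<open>chains\<close> requires values in \<open>M\<close> at every list, also outside
  the support, which is why 0 has to lie in \<open>M\<close>.\<close>

lemma chains_eq:
  assumes "(\<lambda>x. 0) \<in> M"
  shows "chains \<Gamma> M p = poly_mapping.lookup ` bar_chains \<Gamma> M p"
proof
  show "chains \<Gamma> M p \<subseteq> poly_mapping.lookup ` bar_chains \<Gamma> M p"
  proof
    fix c assume c: "c \<in> chains \<Gamma> M p"
    then have "finite {gs. c gs \<noteq> 0}"
      by (simp add: chains_def zero_fun_def)
    then have l: "poly_mapping.lookup (Abs_poly_mapping c) = c"
      by simp
    then have "Abs_poly_mapping c \<in> bar_chains \<Gamma> M p"
      using c by (auto simp: bar_chains_def in_keys_iff chains_def zero_fun_def)
    then show "c \<in> poly_mapping.lookup ` bar_chains \<Gamma> M p"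
      using l by (metis image_eqI)
  qed
  show "poly_mapping.lookup ` bar_chains \<Gamma> M p \<subseteq> chains \<Gamma> M p"
  proof
    fix c assume "c \<in> poly_mapping.lookup ` bar_chains \<Gamma> M p"
    then obtain d where d: "d \<in> bar_chains \<Gamma> M p" "c = poly_mapping.lookup d" by auto
    have "{gs. c gs \<noteq> (\<lambda>x. 0)} = Poly_Mapping.keys d"
      by (auto simp: d in_keys_iff zero_fun_def)
    moreover have "c gs \<in> M" for gs
      using d assms by (cases "gs \<in> Poly_Mapping.keys d") (auto simp: bar_chains_def in_keys_iff zero_fun_def)
    ultimately show "c \<in> chains \<Gamma> M p"
      using d(1) by (auto simp: chains_def bar_chains_def)
  qed
qed

text \<open>The multiplier is 1. The set \<open>Q\<close> of integer combinations of
  \<open>?S\<close> plus boundaries is a subgroup containing all generators, hence all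
  cycles.\<close>

lemma homology_rat_fin_dim_if_fg:
  assumes M: "submod A M" and fg: "bar_homology_fg translate \<Gamma> M p"
  shows "homology_rat_fin_dim \<Gamma> M p"
proof -
  have "(\<lambda>x. 0) \<in> M"
    using submod_zero[OF M] by (simp add: zero_fun_def)
  note ch = chains_eq[OF this]
  have cyc: "cycles \<Gamma> M p = poly_mapping.lookup ` bar_cycles translate \<Gamma> M p"
    by (auto simp: cycles_def bar_cycles_def ch bd_lookup zero_poly_mapping.rep_eq
        poly_mapping_eq_iff zero_fun_def fun_eq_iff)
  obtain S where S: "finite S" "S \<subseteq> bar_cycles translate \<Gamma> M p"
    "bar_cycles translate \<Gamma> M p \<subseteq> gen {} (S \<union> bar_bd translate ` bar_chains \<Gamma> M (Suc p))"
    using fg by (auto simp: bar_homology_fg_def)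
  let ?S = "poly_mapping.lookup ` S"
  define Q where "Q = {c. \<exists>k. \<exists>w\<in>bar_chains \<Gamma> M (Suc p). \<forall>gs x. poly_mapping.lookup c gs x =
      (\<Sum>s\<in>?S. k s * s gs x) + poly_mapping.lookup (bar_bd translate w) gs x}"
  have QI: "c \<in> Q" if "w \<in> bar_chains \<Gamma> M (Suc p)" "\<And>gs x. poly_mapping.lookup c gs x =
      (\<Sum>s\<in>?S. k s * s gs x) + poly_mapping.lookup (bar_bd translate w) gs x" for c k w
    unfolding Q_def using that by (intro CollectI exI[of _ k] bexI[of _ w]) auto
  note bdadd = translate.additive_bar_bd
  note chM = submod_bar_chains[OF M, of \<Gamma> "Suc p"]
  have "submod {} Q"
  proof (rule submodI)
    show "0 \<in> Q"
      by (rule QI[OF submod_zero[OF chM], where k = "\<lambda>_. 0"]) (simp add: additive.zero[OF bdadd])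
    fix c d assume "c \<in> Q" "d \<in> Q"
    then obtain k w k' w' where *: "w \<in> bar_chains \<Gamma> M (Suc p)" "w' \<in> bar_chains \<Gamma> M (Suc p)"
      "\<And>gs x. poly_mapping.lookup c gs x = (\<Sum>s\<in>?S. k s * s gs x) + poly_mapping.lookup (bar_bd translate w) gs x"
      "\<And>gs x. poly_mapping.lookup d gs x = (\<Sum>s\<in>?S. k' s * s gs x) + poly_mapping.lookup (bar_bd translate w') gs x"
      unfolding Q_def by blast
    have "poly_mapping.lookup (c - d) gs x =
      (\<Sum>s\<in>?S. (k s - k' s) * s gs x) + poly_mapping.lookup (bar_bd translate (w - w')) gs x" for gs x
      by (simp add: lookup_minus *(3,4) additive.diff[OF bdadd] left_diff_distrib sum_subtractf)
    then show "c - d \<in> Q"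
      by (rule QI[OF submod_diff[OF chM *(1,2)]])
  qed auto
  moreover have "S \<union> bar_bd translate ` bar_chains \<Gamma> M (Suc p) \<subseteq> Q"
  proof
    fix c assume "c \<in> S \<union> bar_bd translate ` bar_chains \<Gamma> M (Suc p)"
    then consider "c \<in> S" | w where "w \<in> bar_chains \<Gamma> M (Suc p)" "c = bar_bd translate w" by blast
    then show "c \<in> Q"
    proof cases
      case 1
      have "poly_mapping.lookup c gs x =
        (\<Sum>s\<in>?S. (if s = poly_mapping.lookup c then 1 else 0) * s gs x)
          + poly_mapping.lookup (bar_bd translate 0) gs x" for gs x
        using 1 S(1) by (simp add: additive.zero[OF bdadd] if_distrib[of "\<lambda>u. u * _"] sum.delta cong: if_cong)
      then show ?thesis
        by (rule QI[OF submod_zero[OF chM]])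
    next
      case 2
      have "poly_mapping.lookup c gs x = (\<Sum>s\<in>?S. 0 * s gs x) + poly_mapping.lookup (bar_bd translate w) gs x" for gs x
        by (simp add: 2)
      then show ?thesis
        by (rule QI[OF 2(1)])
    qed
  qed
  ultimately have Q: "bar_cycles translate \<Gamma> M p \<subseteq> Q"
    using S(3) gen_minimal by blast
  show ?thesis
    unfolding homology_rat_fin_dim_def
  proof (intro exI[of _ ?S] conjI ballI)
    show "finite ?S" using S by auto
    show "?S \<subseteq> cycles \<Gamma> M p" using S cyc by auto
    fix z assume "z \<in> cycles \<Gamma> M p"
    then obtain c where c: "c \<in> Q" "z = poly_mapping.lookup c"
      using cyc Q by auto
    then obtain k w where kw: "w \<in> bar_chains \<Gamma> M (Suc p)"
      "\<And>gs x. z gs x = (\<Sum>s\<in>?S. k s * s gs x) + poly_mapping.lookup (bar_bd translate w) gs x"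
      unfolding Q_def by auto
    have "(\<lambda>gs x. 1 * z gs x - (\<Sum>s\<in>?S. k s * s gs x)) = bd (poly_mapping.lookup w)"
      by (simp add: kw(2) bd_lookup)
    moreover have "poly_mapping.lookup w \<in> chains \<Gamma> M (Suc p)"
      using kw(1) ch by auto
    ultimately show "\<exists>n::int. n \<noteq> 0 \<and> (\<exists>k. \<exists>w\<in>chains \<Gamma> M (Suc p).
        (\<lambda>gs x. n * z gs x - (\<Sum>s\<in>?S. k s * s gs x)) = bd w)"
      by (intro exI[of _ 1]) auto
  qed
qed

section \<open>Cones of a translation-invariant hyperplane arrangement\<close>

text \<open>\<open>v\<close> vanishes on all directions orthogonal to \<open>u\<close>, in
  particular on its own component orthogonal to \<open>u\<close>, so that component is 0.\<close>

lemma hyperplane_eq_scaled: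
  fixes u v :: "'v::euclidean_space"
  assumes eq: "{x. u \<bullet> x = c} = {x. v \<bullet> x = d}" and "u \<noteq> 0" "v \<noteq> 0"
  obtains t where "t \<noteq> 0" "v = t *\<^sub>R u" "d = t * c"
proof -
  define x0 where "x0 = (c / (u \<bullet> u)) *\<^sub>R u"
  have x0: "u \<bullet> x0 = c" using assms(2) by (simp add: x0_def)
  then have vx0: "v \<bullet> x0 = d" using eq by blast
  have orth: "v \<bullet> y = 0" if "u \<bullet> y = 0" for y
  proof -
    have "u \<bullet> (x0 + y) = c" using that x0 by (simp add: inner_add_right)
    then have "v \<bullet> (x0 + y) = d" using eq by blast
    then show ?thesis using vx0 by (simp add: inner_add_right)
  qed
  define t where "t = (u \<bullet> v) / (u \<bullet> u)"
  define y where "y = v - t *\<^sub>R u"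
  have "u \<bullet> y = 0" using assms(2) by (simp add: y_def t_def inner_diff_right)
  then have "y \<bullet> y = 0"
    using orth[of y] by (simp add: y_def inner_diff_left)
  then have v: "v = t *\<^sub>R u" by (simp add: y_def)
  moreover have "t \<noteq> 0" using v assms(3) by auto
  moreover have "d = t * c" using vx0 x0 v by simp
  ultimately show thesis using that by blast
qed

section \<open>Walls and cones of the arrangement\<close>

locale arrangement =
  fixes \<Gamma> :: "'v::euclidean_space set" and a :: "nat \<Rightarrow> 'v" and b :: "nat \<Rightarrow> real" and f :: nat
  assumes \<Gamma>: "submod {} \<Gamma>" and normal_nonzero: "\<And>i. i < f \<Longrightarrow> a i \<noteq> 0"
    and normals_span: "span (a ` {..<f}) = UNIV"
    and finite_orbits: "finite (Gamma_orbit \<Gamma> ` singular_points (Cfam \<Gamma> a b f))"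
begin

abbreviation "C \<equiv> Cfam \<Gamma> a b f"

text \<open>A hyperplane of \<open>C\<close> is recorded by the index of its normal and its level.
  Unlike the bare set, this fixes a positive side.\<close>

definition walls :: "(nat \<times> real) set" where
  "walls = {(i, b i + a i \<bullet> g) | i g. i < f \<and> g \<in> \<Gamma>}"

text \<open>Positive sides suffice: within V' the negative side of a wall is the complement of the
  positive one, and \<open>cone_ind {}\<close> is the indicator function of V'.\<close>

definition cone_ind :: "(nat \<times> real) set \<Rightarrow> 'v \<Rightarrow> int" where
  "cone_ind A x = of_bool (x \<in> Vprime C \<and> (\<forall>(i, c)\<in>A. a i \<bullet> x > c))"

definition sgn_cone :: "(nat \<times> real) set \<Rightarrow> (nat \<times> real) set \<Rightarrow> 'v \<Rightarrow> int" where
  "sgn_cone A X x = of_bool (x \<in> Vprime C \<and> (\<forall>k\<in>A. if k \<in> X then a (fst k) \<bullet> x < snd k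
     else a (fst k) \<bullet> x > snd k))"

text \<open>Independence of the normals as a family indexed by \<open>A\<close>, so two different
  walls in \<open>A\<close> with the same normal count as dependent.\<close>

definition indep :: "(nat \<times> real) set \<Rightarrow> bool" where
  "indep A \<longleftrightarrow> (\<forall>u. (\<Sum>k\<in>A. u k *\<^sub>R a (fst k)) = 0 \<longrightarrow> (\<forall>k\<in>A. u k = 0))"

lemma Cfam_eq: "C = (\<lambda>(i, c). {x. a i \<bullet> x = c}) ` walls"
proof -
  have "(\<lambda>x. x + g) ` hyp a b i = {x. a i \<bullet> x = b i + a i \<bullet> g}" for i g
  proof -
    have "x \<in> (\<lambda>x. x + g) ` hyp a b i" if "a i \<bullet> x = b i + a i \<bullet> g" for x
      using that by (intro image_eqI[of _ _ "x - g"]) (auto simp: hyp_def inner_diff_right)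
    then show ?thesis by (auto simp: hyp_def inner_add_right)
  qed
  then show ?thesis
    unfolding Cfam_def walls_def by (auto simp: image_iff)
qed

lemma Vprime_not_on_wall: "x \<in> Vprime C \<Longrightarrow> k \<in> walls \<Longrightarrow> a (fst k) \<bullet> x \<noteq> snd k"
  unfolding Vprime_def Cfam_eq by (auto simp: split_def)

lemma walls_index: "k \<in> walls \<Longrightarrow> fst k < f"
  by (auto simp: walls_def)

lemma wall_translate:
  assumes "g \<in> \<Gamma>" "(i, c) \<in> walls"
  shows "(i, c + a i \<bullet> g) \<in> walls"
proof -
  obtain h where h: "i < f" "h \<in> \<Gamma>" "c = b i + a i \<bullet> h"
    using assms by (auto simp: walls_def)
  have "c + a i \<bullet> g = b i + a i \<bullet> (h + g)"
    by (simp add: h inner_add_right)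
  then show ?thesis
    using h submod_add[OF \<Gamma> h(2) assms(1)] unfolding walls_def by blast
qed

lemma Cfam_translate:
  assumes "g \<in> \<Gamma>" "W \<in> C"
  shows "(+) g ` W \<in> C"
proof -
  obtain i c where k: "(i, c) \<in> walls" "W = {x. a i \<bullet> x = c}"
    using assms(2) unfolding Cfam_eq by auto
  have "(+) g ` W = {x. a i \<bullet> x = c + a i \<bullet> g}"
  proof -
    have "x \<in> (+) g ` W" if "a i \<bullet> x = c + a i \<bullet> g" for x
      using that by (intro image_eqI[of _ _ "x - g"]) (auto simp: k inner_diff_right)
    then show ?thesis by (auto simp: k inner_add_right)
  qed
  then show ?thesis
    unfolding Cfam_eq using wall_translate[OF assms(1) k(1)] by (auto intro: rev_image_eqI)
qed

lemma Vprime_translate: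
  assumes "g \<in> \<Gamma>"
  shows "x - g \<in> Vprime C \<longleftrightarrow> x \<in> Vprime C"
proof -
  have *: "y + h \<in> \<Union>C" if "y \<in> \<Union>C" "h \<in> \<Gamma>" for y h
    using that Cfam_translate[of h] by (metis UnionE UnionI add.commute image_eqI)
  show ?thesis
    using *[of "x - g" g] *[of x "- g"] assms submod_uminus[OF \<Gamma>] unfolding Vprime_def by auto
qed

lemma cone_mult: "cone_ind A x * cone_ind B x = cone_ind (A \<union> B) x"
  by (auto simp: cone_ind_def)

section \<open>Linear relations between cones\<close>

lemma sgn_cone_insert:
  assumes "k \<in> A" "k \<notin> X" "k \<in> walls"
  shows "sgn_cone A (insert k X) = sgn_cone (A - {k}) X - sgn_cone A X"
proof
  fix x
  define Z where "Z \<longleftrightarrow> (\<forall>j\<in>A - {k}. if j \<in> X then a (fst j) \<bullet> x < snd j else a (fst j) \<bullet> x > snd j)"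
  have split: "(\<forall>j\<in>A. R j) \<longleftrightarrow> R k \<and> (\<forall>j\<in>A - {k}. R j)" for R
    using assms(1) by blast
  have "sgn_cone A (insert k X) x = of_bool (x \<in> Vprime C \<and> a (fst k) \<bullet> x < snd k \<and> Z)"
    unfolding sgn_cone_def Z_def split[of "\<lambda>j. if j \<in> insert k X then _ j else _ j"] by simp
  moreover have "sgn_cone A X x = of_bool (x \<in> Vprime C \<and> a (fst k) \<bullet> x > snd k \<and> Z)"
    unfolding sgn_cone_def Z_def split[of "\<lambda>j. if j \<in> X then _ j else _ j"] using assms(2) by simp
  moreover have "sgn_cone (A - {k}) X x = of_bool (x \<in> Vprime C \<and> Z)"
    unfolding sgn_cone_def Z_def ..
  ultimately show "sgn_cone A (insert k X) x = (sgn_cone (A - {k}) X - sgn_cone A X) x"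
    using Vprime_not_on_wall[OF _ assms(3), of x] by (cases "a (fst k) \<bullet> x < snd k") auto
qed

text \<open>Reversing the walls of \<open>X\<close> one at a time gives the inclusion-exclusion
  expansion, in which \<open>cone_ind A\<close> has coefficient (-1)^card X. Only invertibility of
  this sign is needed later, hence the disjunction.\<close>

lemma sgn_cone_expand:
  assumes "finite X" "X \<subseteq> A" "A \<subseteq> walls"
  shows "sgn_cone A X - cone_ind A \<in> gen {} (cone_ind ` {B. B \<subset> A}) \<or>
    sgn_cone A X + cone_ind A \<in> gen {} (cone_ind ` {B. B \<subset> A})"
  using assms
proof (induction X arbitrary: A rule: finite_induct)
  case empty
  have "sgn_cone A {} - cone_ind A = 0"
    by (auto simp: sgn_cone_def cone_ind_def fun_eq_iff split_def)
  then show ?case using gen.zero by metis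
next
  case (insert k X)
  let ?G = "gen {} (cone_ind ` {B. B \<subset> A})" and ?A = "A - {k}"
  have G: "submod {} ?G" by (rule submod_gen)
  have sub: "gen {} (cone_ind ` {B. B \<subset> ?A}) \<subseteq> ?G"
    by (rule gen_mono) auto
  have "cone_ind ?A \<in> ?G"
    using insert.prems by (intro gen.base) auto
  moreover have "sgn_cone ?A X - cone_ind ?A \<in> ?G \<or> sgn_cone ?A X + cone_ind ?A \<in> ?G"
    using insert.IH[of ?A] insert.prems insert.hyps sub by blast
  ultimately have "(sgn_cone ?A X - cone_ind ?A) + cone_ind ?A \<in> ?G \<or> (sgn_cone ?A X + cone_ind ?A) - cone_ind ?A \<in> ?G"
    using submod_add[OF G] submod_diff[OF G] by blast
  then have 1: "sgn_cone ?A X \<in> ?G" by simp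
  have 2: "sgn_cone A (insert k X) = sgn_cone ?A X - sgn_cone A X"
    using insert by (intro sgn_cone_insert) auto
  have "sgn_cone A X - cone_ind A \<in> ?G \<or> sgn_cone A X + cone_ind A \<in> ?G"
    using insert by blast
  then have "sgn_cone ?A X - (sgn_cone A X - cone_ind A) \<in> ?G \<or> sgn_cone ?A X - (sgn_cone A X + cone_ind A) \<in> ?G"
    using submod_diff[OF G 1] by blast
  moreover have "x - (y - z) = (x - y) + z" "x - (y + z) = (x - y) - z" for x y z :: "'v \<Rightarrow> int"
    by (simp_all add: fun_eq_iff)
  ultimately show ?case unfolding 2 by metis
qed

text \<open>For a dependency \<open>\<Sum>k\<in>A. u k *\<^sub>R a (fst k) = 0\<close>, of the two regions on which all
  \<open>u k * (a (fst k) \<bullet> x - snd k)\<close> with \<open>u k \<noteq> 0\<close> have the same sign, one is empty;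
  expanding its indicator function expresses \<open>cone_ind A\<close> by smaller cones.\<close>
lemma cone_dependent:
  assumes "finite A" "A \<subseteq> walls" and dep: "(\<Sum>k\<in>A. u k *\<^sub>R a (fst k)) = 0" and k0: "k0 \<in> A" "u k0 \<noteq> 0"
  shows "cone_ind A \<in> gen {} (cone_ind ` {B. B \<subset> A})"
proof -
  let ?G = "gen {} (cone_ind ` {B. B \<subset> A})"
  \<comment> \<open>At such a point \<open>x\<close> all terms
    \<open>w k * (a (fst k) \<bullet> x - snd k)\<close> are nonnegative and the one for
    \<open>k0\<close> is positive, while the normals cancel, so only the levels remain. Applied to
    \<open>u\<close> and to \<open>- u\<close>, this yields opposite signs for one and the same
    sum.\<close>
  have pos: "(\<Sum>k\<in>A. w k * snd k) < 0"
    if x: "sgn_cone A {k \<in> A. w k < 0} x \<noteq> 0" and w: "(\<Sum>k\<in>A. w k *\<^sub>R a (fst k)) = 0" "w k0 \<noteq> 0" for w x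
  proof -
    have sgn: "if w k < 0 then a (fst k) \<bullet> x < snd k else a (fst k) \<bullet> x > snd k" if "k \<in> A" for k
      using x that by (auto simp: sgn_cone_def)
    have "0 < (\<Sum>k\<in>A. w k * (a (fst k) \<bullet> x - snd k))"
    proof (rule sum_pos2[OF assms(1) k0(1)])
      show "0 < w k0 * (a (fst k0) \<bullet> x - snd k0)"
        using sgn[OF k0(1)] w(2) by (auto simp: zero_less_mult_iff split: if_splits)
      show "0 \<le> w k * (a (fst k) \<bullet> x - snd k)" if "k \<in> A" for k
        using sgn[OF that] by (auto simp: zero_le_mult_iff split: if_splits)
    qed
    also have "\<dots> = (\<Sum>k\<in>A. w k *\<^sub>R a (fst k)) \<bullet> x - (\<Sum>k\<in>A. w k * snd k)"
      by (simp add: inner_sum_left right_diff_distrib sum_subtractf)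
    finally show ?thesis using w by simp
  qed
  have "sgn_cone A {k \<in> A. u k < 0} = 0 \<or> sgn_cone A {k \<in> A. - u k < 0} = 0"
  proof (rule ccontr)
    assume "\<not> ?thesis"
    then obtain x y where xy: "sgn_cone A {k \<in> A. u k < 0} x \<noteq> 0" "sgn_cone A {k \<in> A. - u k < 0} y \<noteq> 0"
      unfolding fun_eq_iff zero_fun_apply by blast
    have "(\<Sum>k\<in>A. - u k *\<^sub>R a (fst k)) = 0" "- u k0 \<noteq> 0"
      using dep k0(2) by (simp_all add: sum_negf)
    from pos[OF xy(1) dep k0(2)] pos[OF xy(2) this] show False
      by (simp add: sum_negf)
  qed
  moreover have *: "cone_ind A \<in> ?G" if X: "X \<subseteq> A" "sgn_cone A X = 0" for X
  proof -
    have "finite X" using assms(1) X(1) finite_subset by blast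
    from sgn_cone_expand[OF this X(1) assms(2)] have "0 - cone_ind A \<in> ?G \<or> 0 + cone_ind A \<in> ?G"
      unfolding X(2) .
    then show ?thesis
      using submod_uminus[OF submod_gen, of "- cone_ind A"] by (metis add_0 diff_0 minus_minus)
  qed
  ultimately show ?thesis
    by (elim disjE *[OF Collect_restrict])
qed

lemma cone_in_gen_indep:
  assumes "finite A" "A \<subseteq> walls"
  shows "cone_ind A \<in> gen {} (cone_ind ` {B. finite B \<and> B \<subseteq> walls \<and> indep B})"
  using assms
proof (induction A rule: finite_psubset_induct)
  case (psubset A)
  let ?G = "gen {} (cone_ind ` {B. finite B \<and> B \<subseteq> walls \<and> indep B})"
  show ?case
  proof (cases "indep A")
    case True
    then show ?thesis using psubset by (intro gen.base) auto
  next
    case False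
    then obtain u k0 where "(\<Sum>k\<in>A. u k *\<^sub>R a (fst k)) = 0" "k0 \<in> A" "u k0 \<noteq> 0"
      by (auto simp: indep_def)
    then have "cone_ind A \<in> gen {} (cone_ind ` {B. B \<subset> A})"
      using psubset by (intro cone_dependent) auto
    moreover have "gen {} (cone_ind ` {B. B \<subset> A}) \<subseteq> ?G"
      using psubset by (intro gen_minimal submod_gen) auto
    ultimately show ?thesis by blast
  qed
qed

section \<open>Independent walls and singular points\<close>

lemma indep_inj_on:
  assumes "finite A" "indep A"
  shows "inj_on (\<lambda>k. a (fst k)) A"
proof (rule inj_onI, rule ccontr)
  fix k l assume *: "k \<in> A" "l \<in> A" "a (fst k) = a (fst l)" "k \<noteq> l"
  let ?u = "\<lambda>j. (if j = k then 1 else 0) - (if j = l then 1 else 0) :: real"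
  have "(\<Sum>j\<in>A. ?u j *\<^sub>R a (fst j)) = 0"
    using * assms(1)
    by (simp add: scaleR_left_diff_distrib sum_subtractf if_distrib[of "\<lambda>r. r *\<^sub>R _"] cong: if_cong)
  then have "?u k = 0" using assms(2) *(1) unfolding indep_def by (elim allE[of _ ?u]) blast
  then show False using * by simp
qed

lemma indep_independent:
  assumes "finite A" "indep A"
  shows "independent ((\<lambda>k. a (fst k)) ` A)"
proof (rule independent_if_scalars_zero)
  fix u v assume sum0: "(\<Sum>x\<in>(\<lambda>k. a (fst k)) ` A. u x *\<^sub>R x) = 0" and "v \<in> (\<lambda>k. a (fst k)) ` A"
  then have "(\<Sum>k\<in>A. u (a (fst k)) *\<^sub>R a (fst k)) = 0"
    by (simp add: sum.reindex[OF indep_inj_on[OF assms]] o_def)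
  then have "\<forall>k\<in>A. u (a (fst k)) = 0"
    using assms(2) unfolding indep_def by (elim allE[of _ "\<lambda>k. u (a (fst k))"]) blast
  then show "u v = 0" using \<open>v \<in> _\<close> by auto
qed (use assms in auto)

text \<open>As the normals span, those of \<open>A\<close> extend to a basis of V consisting of
  normals of the arrangement. One wall for each basis vector gives hyperplanes of \<open>C\<close>
  that meet in exactly one point.\<close>

lemma indep_through_singular_point:
  assumes "finite A" "A \<subseteq> walls" "indep A"
  obtains x where "x \<in> singular_points C" "\<And>i c. (i, c) \<in> A \<Longrightarrow> a i \<bullet> x = c"
proof -
  let ?n = "\<lambda>k. a (fst k)"
  obtain D where D: "?n ` A \<subseteq> D" "D \<subseteq> ?n ` A \<union> a ` {..<f}" "independent D"
    "?n ` A \<union> a ` {..<f} \<subseteq> span D"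
    using maximal_independent_subset_extend[OF _ indep_independent[OF assms(1,3)], of "?n ` A \<union> a ` {..<f}"]
    by auto
  have "span (a ` {..<f}) \<subseteq> span D"
    using D(4) span_mono[of _ "span D"] by (metis le_sup_iff span_span)
  then have spanD: "span D = UNIV" using normals_span by auto
  \<comment> \<open>The wall chosen for a basis normal belongs to \<open>A\<close> whenever
    \<open>A\<close> has one with this normal; otherwise it is an untranslated hyperplane of the
    family.\<close>
  have "\<exists>k. k \<in> walls \<and> ?n k = v \<and> (v \<in> ?n ` A \<longrightarrow> k \<in> A)" if "v \<in> D" for v
  proof (cases "v \<in> ?n ` A")
    case True
    then show ?thesis using assms(2) by blast
  next
    case False
    then have "v \<in> a ` {..<f}" using D(2) that by blast
    then obtain i where i: "i < f" "v = a i" by auto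
    then have "(i, b i + a i \<bullet> 0) \<in> walls"
      using submod_zero[OF \<Gamma>] unfolding walls_def by blast
    then show ?thesis using i False by (intro exI[of _ "(i, b i)"]) auto
  qed
  then obtain \<kappa> where \<kappa>: "\<And>v. v \<in> D \<Longrightarrow> \<kappa> v \<in> walls" "\<And>v. v \<in> D \<Longrightarrow> ?n (\<kappa> v) = v"
    "\<And>v. v \<in> D \<Longrightarrow> v \<in> ?n ` A \<Longrightarrow> \<kappa> v \<in> A"
    by metis
  \<comment> \<open>The common point is the vector representing the linear functional that takes the
    prescribed level on each basis normal.\<close>
  obtain l :: "'v \<Rightarrow> real" where l: "linear l" "\<And>v. v \<in> D \<Longrightarrow> l v = snd (\<kappa> v)"
    using linear_independent_extend[OF D(3), of "\<lambda>v. snd (\<kappa> v)"] by auto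
  define x where "x = adjoint l 1"
  have x: "v \<bullet> x = l v" for v
    using adjoint_works[OF l(1), of v 1] by (simp add: x_def)
  let ?S = "(\<lambda>v. {y. v \<bullet> y = snd (\<kappa> v)}) ` D"
  have "\<Inter>?S = {x}"
  proof
    show "{x} \<subseteq> \<Inter>?S" using x l(2) by auto
    show "\<Inter>?S \<subseteq> {x}"
    proof
      fix y assume "y \<in> \<Inter>?S"
      then have "D \<subseteq> {v. v \<bullet> (y - x) = 0}"
        using x l(2) by (auto simp: inner_diff_right)
      then have "span D \<subseteq> {v. v \<bullet> (y - x) = 0}"
        by (rule span_minimal) (auto simp: subspace_def inner_add_left)
      then have "(y - x) \<bullet> (y - x) = 0" using spanD by blast
      then show "y \<in> {x}" by simp
    qed
  qed
  moreover have "?S \<subseteq> C"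
  proof -
    have "{y. v \<bullet> y = snd (\<kappa> v)} \<in> C" if "v \<in> D" for v
      unfolding Cfam_eq using \<kappa>(1,2)[OF that] by (intro image_eqI[of _ _ "\<kappa> v"]) (auto simp: split_def)
    then show ?thesis by blast
  qed
  \<comment> \<open>\<open>singular_points\<close> asks for a nonempty family of
    hyperplanes.\<close>
  moreover have "D \<noteq> {}"
  proof
    assume "D = {}"
    then have "(UNIV :: 'v set) = {0}" using spanD by simp
    then show False using nonzero_Basis SOME_Basis by (metis UNIV_I singletonD)
  qed
  ultimately have sing: "x \<in> singular_points C"
    unfolding singular_points_def by blast
  have "a i \<bullet> x = c" if "(i, c) \<in> A" for i c
  proof -
    have v: "a i \<in> ?n ` A" using that by force
    then have "a i \<in> D" using D(1) by blast
    \<comment> \<open>The walls of an independent \<open>A\<close> have distinct normals, so the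
      wall of \<open>A\<close> chosen for \<open>a i\<close> can only be
      \<open>(i, c)\<close>.\<close>
    then have "\<kappa> (a i) = (i, c)"
      using \<kappa>(2,3)[of "a i"] v that inj_onD[OF indep_inj_on[OF assms(1,3)], of "\<kappa> (a i)" "(i, c)"] by auto
    then show ?thesis using x l(2)[OF \<open>a i \<in> D\<close>] by simp
  qed
  with sing show thesis using that by blast
qed

lemma cones_finitely_generated:
  obtains S where "finite S"
    "\<And>A. finite A \<Longrightarrow> A \<subseteq> walls \<Longrightarrow> cone_ind A \<in> gen (translate ` \<Gamma>) S"
proof -
  obtain F where F: "F \<subseteq> singular_points C" "finite F"
    "Gamma_orbit \<Gamma> ` singular_points C = Gamma_orbit \<Gamma> ` F"
    using finite_subset_image[OF finite_orbits order_refl] by blast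
  \<comment> \<open>For each orbit representative \<open>x\<close> and each set \<open>I\<close> of
    indices, the cone with apex condition given by the levels \<open>a i \<bullet> x\<close>. Some
    of these levels may not belong to walls; what counts is that \<open>S\<close> is finite and
    contains, up to translation, every cone with independent normals.\<close>
  define S where "S = (\<lambda>(x, I). cone_ind ((\<lambda>i. (i, a i \<bullet> x)) ` I)) ` (F \<times> Pow {..<f})"
  have indep: "cone_ind A \<in> gen (translate ` \<Gamma>) S" if A: "finite A" "A \<subseteq> walls" "indep A" for A
  proof -
    obtain x where x: "x \<in> singular_points C" "\<And>i c. (i, c) \<in> A \<Longrightarrow> a i \<bullet> x = c"
      using indep_through_singular_point[OF A] by blast
    then obtain x0 where x0: "x0 \<in> F" "Gamma_orbit \<Gamma> x = Gamma_orbit \<Gamma> x0"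
      using F(3) by (metis imageE imageI)
    have "x \<in> Gamma_orbit \<Gamma> x"
      using submod_zero[OF \<Gamma>] by (force simp: Gamma_orbit_def)
    then obtain g where g: "g \<in> \<Gamma>" "x = x0 + g"
      unfolding x0(2) by (auto simp: Gamma_orbit_def)
    let ?c = "cone_ind ((\<lambda>i. (i, a i \<bullet> x0)) ` fst ` A)"
    have "(\<forall>(i, c)\<in>(\<lambda>i. (i, a i \<bullet> x0)) ` fst ` A. c < a i \<bullet> (y - g)) \<longleftrightarrow> (\<forall>(i, c)\<in>A. c < a i \<bullet> y)" for y
    proof -
      have "a i \<bullet> x0 < a i \<bullet> (y - g) \<longleftrightarrow> c < a i \<bullet> y" if "(i, c) \<in> A" for i c
        using x(2)[OF that] g(2) by (auto simp: inner_diff_right inner_add_right)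
      then show ?thesis by fastforce
    qed
    then have eq: "cone_ind A = translate g ?c"
      by (auto simp: fun_eq_iff translate_def cone_ind_def Vprime_translate[OF g(1)])
    have "?c \<in> S"
      unfolding S_def using x0(1) A(2) walls_index by (intro image_eqI[of _ _ "(x0, fst ` A)"]) auto
    then have "?c \<in> gen (translate ` \<Gamma>) S" by (rule gen.base)
    then show ?thesis
      unfolding eq by (rule submod_app[OF submod_gen imageI[OF g(1)]])
  qed
  show thesis
  proof
    show "finite S" using F(2) by (auto simp: S_def)
    fix A assume "finite A" "A \<subseteq> walls"
    then have "cone_ind A \<in> gen {} (cone_ind ` {B. finite B \<and> B \<subseteq> walls \<and> indep B})"
      by (rule cone_in_gen_indep)
    also have "\<dots> \<subseteq> gen (translate ` \<Gamma>) S"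
      by (rule gen_minimal[OF submod_mono[OF submod_gen]]) (use indep in auto)
    finally show "cone_ind A \<in> gen (translate ` \<Gamma>) S" .
  qed
qed

section \<open>The ring of cones and the C-topes\<close>

definition cone_ring :: "('v \<Rightarrow> int) set" where
  "cone_ring = gen {} (cone_ind ` {A. finite A \<and> A \<subseteq> walls})"

lemma submod_cone_ring: "submod {} cone_ring"
  unfolding cone_ring_def by (rule submod_gen)

lemma cone_in_cone_ring: "finite A \<Longrightarrow> A \<subseteq> walls \<Longrightarrow> cone_ind A \<in> cone_ring"
  unfolding cone_ring_def by (intro gen.base) auto

text \<open>\<open>cone_ring\<close> is generated as a group only. Products stay inside because the
  intersection of two cones is again a cone; additivity is used in one factor at a time.\<close>

lemma cone_ring_mult:
  assumes "\<phi> \<in> cone_ring" "\<psi> \<in> cone_ring"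
  shows "\<phi> * \<psi> \<in> cone_ring"
proof -
  note R = submod_cone_ring
  have 1: "\<eta> * cone_ind B \<in> cone_ring" if "\<eta> \<in> cone_ring" "finite B" "B \<subseteq> walls" for \<eta> B
  proof -
    have "cone_ring \<subseteq> {\<eta>. \<eta> * cone_ind B \<in> cone_ring}"
      unfolding cone_ring_def
    proof (rule gen_minimal, fold cone_ring_def)
      show "submod {} {\<eta>. \<eta> * cone_ind B \<in> cone_ring}"
        using submod_zero[OF R] submod_diff[OF R] by (intro submodI) (auto simp: left_diff_distrib)
      have "cone_ind A * cone_ind B = cone_ind (A \<union> B)" for A
        by (simp add: fun_eq_iff cone_mult)
      then show "cone_ind ` {A. finite A \<and> A \<subseteq> walls} \<subseteq> {\<eta>. \<eta> * cone_ind B \<in> cone_ring}"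
        using that by (auto intro!: cone_in_cone_ring)
    qed
    then show ?thesis using that by blast
  qed
  have "cone_ring \<subseteq> {\<psi>. \<phi> * \<psi> \<in> cone_ring}"
    unfolding cone_ring_def
  proof (rule gen_minimal, fold cone_ring_def)
    show "submod {} {\<psi>. \<phi> * \<psi> \<in> cone_ring}"
      using submod_zero[OF R] submod_diff[OF R] by (intro submodI) (auto simp: right_diff_distrib)
    show "cone_ind ` {A. finite A \<and> A \<subseteq> walls} \<subseteq> {\<psi>. \<phi> * \<psi> \<in> cone_ring}"
      using 1[OF assms(1)] by auto
  qed
  then show ?thesis using assms(2) by blast
qed

text \<open>No point of V' lies on the wall, so closed and open half-spaces agree there. The factor
  \<open>t\<close> allows any multiple of \<open>a i\<close> as normal: \<open>t > 0\<close> gives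
  the complement of a cone, \<open>t < 0\<close> the cone itself.\<close>

lemma halfspace_in_cone_ring:
  assumes k: "(i, c) \<in> walls" and "t \<noteq> 0"
  shows "(\<lambda>x. of_bool (x \<in> Vprime C \<and> t * (a i \<bullet> x) \<le> t * c)) \<in> cone_ring"
proof -
  have nw: "a i \<bullet> x \<noteq> c" if "x \<in> Vprime C" for x
    using Vprime_not_on_wall[OF that k] by simp
  have c1: "cone_ind {(i, c)} \<in> cone_ring" "cone_ind {} \<in> cone_ring"
    using k by (auto intro: cone_in_cone_ring)
  show ?thesis
  proof (cases "t > 0")
    case True
    then have "(\<lambda>x. of_bool (x \<in> Vprime C \<and> t * (a i \<bullet> x) \<le> t * c)) = cone_ind {} - cone_ind {(i, c)}"
      using nw by (auto simp: fun_eq_iff cone_ind_def not_less)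
    then show ?thesis using submod_diff[OF submod_cone_ring c1(2,1)] by simp
  next
    case False
    then have "t < 0" using assms(2) by simp
    then have "(\<lambda>x. of_bool (x \<in> Vprime C \<and> t * (a i \<bullet> x) \<le> t * c)) = cone_ind {(i, c)}"
      using nw by (auto simp: fun_eq_iff cone_ind_def mult_le_cancel_left_neg) (metis order_le_less)
    then show ?thesis using c1(1) by simp
  qed
qed

lemma Ctope_in_cone_ring:
  assumes P: "Ctope C P"
  shows "(\<lambda>x. of_bool (x \<in> P \<inter> Vprime C)) \<in> cone_ring"
proof (cases "interior P = {}")
  case True
  then have "P = {}" using P by (auto simp: Ctope_def)
  then show ?thesis using submod_zero[OF submod_cone_ring] by (simp add: zero_fun_def)
next
  case False
  then have aff: "affine hull P = UNIV" by (rule affine_hull_nonempty_interior)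
  have "polyhedron P" using P by (auto simp: Ctope_def intro: polytope_imp_polyhedron)
  \<comment> \<open>The last clause, irredundancy of the half-spaces, ensures that each bounding
    hyperplane cuts out a facet of \<open>P\<close>.\<close>
  then obtain F where F: "finite F" "P = affine hull P \<inter> \<Inter>F"
    "\<And>h. h \<in> F \<Longrightarrow> \<exists>u c. u \<noteq> 0 \<and> h = {x. u \<bullet> x \<le> c}"
    "\<And>F'. F' \<subset> F \<Longrightarrow> P \<subset> affine hull P \<inter> \<Inter>F'"
    unfolding polyhedron_Int_affine_minimal by meson
  then obtain u c where uc: "\<And>h. h \<in> F \<Longrightarrow> u h \<noteq> 0 \<and> h = {x. u h \<bullet> x \<le> c h}"
    by metis
  have half: "(\<lambda>x. of_bool (x \<in> Vprime C \<and> x \<in> h)) \<in> cone_ring" if h: "h \<in> F" for h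
  proof -
    define E where "E = P \<inter> {x. u h \<bullet> x = c h}"
    have E: "E facet_of P"
      using facet_of_polyhedron_explicit[OF F(1,2) uc F(4)] h unfolding E_def by blast
    then obtain W where W: "W \<in> C" "E \<subseteq> W"
      using P by (auto simp: Ctope_def)
    then obtain i d where k: "(i, d) \<in> walls" "W = {x. a i \<bullet> x = d}"
      unfolding Cfam_eq by auto
    have ai: "a i \<noteq> 0" using normal_nonzero walls_index[OF k(1)] by simp
    have dimE: "aff_dim E = int DIM('v) - 1" "E \<noteq> {}"
      using E aff aff_dim_affine_hull[of P] by (auto simp: facet_of_def)
    \<comment> \<open>A facet has codimension 1 and thus spans any hyperplane containing it. So the
      bounding hyperplane of \<open>h\<close> coincides with the member \<open>W\<close> of
      \<open>C\<close> that contains the facet.\<close>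
    have hull: "affine hull E = {x. v \<bullet> x = e}" if "v \<noteq> 0" "E \<subseteq> {x. v \<bullet> x = e}" for v e
    proof (rule affine_dim_equal)
      show "affine hull E \<subseteq> {x. v \<bullet> x = e}"
        by (rule hull_minimal) (use that in \<open>auto simp: affine_hyperplane\<close>)
    qed (use that dimE in \<open>auto simp: affine_hyperplane aff_dim_hyperplane\<close>)
    have "{x. a i \<bullet> x = d} = {x. u h \<bullet> x = c h}"
      using hull[OF ai] hull[of "u h" "c h"] uc[OF h] W(2) k(2) by (auto simp: E_def)
    then obtain t where t: "t \<noteq> 0" "u h = t *\<^sub>R a i" "c h = t * d"
      using hyperplane_eq_scaled[OF _ ai] uc[OF h] by metis
    have "h = {x. t * (a i \<bullet> x) \<le> t * d}"
      using uc[OF h] t by simp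
    then show ?thesis
      using halfspace_in_cone_ring[OF k(1) t(1)] by simp
  qed
  have "(\<lambda>x. of_bool (x \<in> Vprime C \<and> x \<in> \<Inter>F')) \<in> cone_ring" if "F' \<subseteq> F" for F'
    using finite_subset[OF that F(1)] that
  proof (induction F' rule: finite_induct)
    case empty
    have "(\<lambda>x. of_bool (x \<in> Vprime C \<and> x \<in> \<Inter>{})) = cone_ind {}"
      by (simp add: cone_ind_def fun_eq_iff)
    then show ?case using cone_in_cone_ring[of "{}"] by simp
  next
    case (insert h F')
    have "(\<lambda>x. of_bool (x \<in> Vprime C \<and> x \<in> \<Inter>(insert h F'))) =
        (\<lambda>x. of_bool (x \<in> Vprime C \<and> x \<in> h)) * (\<lambda>x. of_bool (x \<in> Vprime C \<and> x \<in> \<Inter>F') :: int)"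
      by (auto simp: fun_eq_iff)
    then show ?case
      using cone_ring_mult[OF half insert.IH] insert.prems by simp
  qed
  moreover have "P = \<Inter>F" using F(2) aff by simp
  ultimately show ?thesis by (simp add: conj_commute)
qed

lemma CV_subset_cone_ring: "CV C \<subseteq> cone_ring"
proof
  fix \<phi> assume "\<phi> \<in> CV C"
  then show "\<phi> \<in> cone_ring"
  proof (induction rule: CV.induct)
    case (ind P)
    then show ?case using Ctope_in_cone_ring[OF ind] by (simp add: of_bool_def)
  next
    case zero
    then show ?case using submod_zero[OF submod_cone_ring] by (simp add: zero_fun_def)
  next
    case (add \<phi> \<psi>)
    then show ?case using submod_add[OF submod_cone_ring, of \<phi> \<psi>] by (simp add: plus_fun_def)
  next
    case (neg \<phi>)
    then show ?case using submod_uminus[OF submod_cone_ring, of \<phi>] by (simp add: fun_Compl_def)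
  next
    case (mult \<phi> \<psi>)
    then show ?case using cone_ring_mult[of \<phi> \<psi>] by (simp add: times_fun_def)
  qed
qed

lemma Ctope_translate:
  assumes P: "Ctope C P" and g: "g \<in> \<Gamma>"
  shows "Ctope C ((+) g ` P)"
proof -
  have "\<exists>W\<in>C. F \<subseteq> W" if F: "F facet_of (+) g ` P" for F
  proof -
    define E where "E = (+) (- g) ` F"
    have FE: "F = (+) g ` E" by (simp add: E_def image_image)
    have "E facet_of P"
      using F unfolding FE facet_of_def by (simp add: aff_dim_translation_eq)
    then obtain W where "W \<in> C" "E \<subseteq> W" using P by (auto simp: Ctope_def)
    then show ?thesis using Cfam_translate[OF g, of W] FE by blast
  qed
  then show ?thesis
    using P unfolding Ctope_def
    by (auto simp: polytope_translation_eq interior_translation closure_translation compact_translation)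
qed

text \<open>Translates of C-topes by \<Gamma> are C-topes, and translation commutes with the
  pointwise operations.\<close>

lemma submod_CV: "submod (translate ` \<Gamma>) (CV C)"
proof (rule submodI)
  show "0 \<in> CV C" using CV.zero by (simp add: zero_fun_def)
  show "\<phi> - \<psi> \<in> CV C" if "\<phi> \<in> CV C" "\<psi> \<in> CV C" for \<phi> \<psi>
    using CV.add[OF that(1) CV.neg[OF that(2)]] by (simp add: fun_diff_def)
  fix t \<phi> assume "t \<in> translate ` \<Gamma>" and \<phi>: "\<phi> \<in> CV C"
  then obtain g where g: "g \<in> \<Gamma>" "t = translate g" by auto
  from \<phi> show "t \<phi> \<in> CV C"
    unfolding g(2)
  proof (induction rule: CV.induct)
    case (ind P)
    have "x \<in> (+) g ` P \<longleftrightarrow> x - g \<in> P" for x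
      by (metis (no_types, lifting) add_diff_cancel_left' diff_add_cancel add.commute image_iff)
    then have "translate g (\<lambda>x. if x \<in> P \<inter> Vprime C then 1 else 0) =
        (\<lambda>x. if x \<in> (+) g ` P \<inter> Vprime C then 1 else 0)"
      by (auto simp: translate_def fun_eq_iff Vprime_translate[OF g(1)])
    then show ?case using CV.ind[OF Ctope_translate[OF ind g(1)]] by simp
  qed (auto simp: translate_def intro: CV.intros)
qed

end

section \<open>Integer spans and the finiteness theorem\<close>

lemma int_span_eq_gen:
  assumes "finite B"
  shows "int_span B = gen {} B"
proof
  show "int_span B \<subseteq> gen {} B"
  proof
    fix x assume "x \<in> int_span B"
    then obtain c where x: "x = (\<Sum>v\<in>B. real_of_int (c v) *\<^sub>R v)"
      by (auto simp: int_span_def)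
    have "real_of_int n *\<^sub>R v = zmul n v" for n and v :: 'a
      by (simp add: zmul_def sum_constant_scaleR flip: scaleR_minus_left)
    then show "x \<in> gen {} B"
      unfolding x by (intro submod_sum[OF submod_gen]) (auto intro: submod_zmul[OF submod_gen] gen.base)
  qed
  show "gen {} B \<subseteq> int_span B"
  proof (rule gen_minimal)
    show "submod {} (int_span B)"
    proof (rule submodI)
      show "0 \<in> int_span B"
        unfolding int_span_def by (auto intro!: exI[of _ "\<lambda>_. 0"])
      fix x y assume "x \<in> int_span B" "y \<in> int_span B"
      then obtain c d where "x = (\<Sum>v\<in>B. real_of_int (c v) *\<^sub>R v)" "y = (\<Sum>v\<in>B. real_of_int (d v) *\<^sub>R v)"
        by (auto simp: int_span_def)
      then have "x - y = (\<Sum>v\<in>B. real_of_int (c v - d v) *\<^sub>R v)"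
        by (simp add: scaleR_left_diff_distrib sum_subtractf)
      then show "x - y \<in> int_span B"
        unfolding int_span_def by (intro CollectI exI[of _ "\<lambda>v. c v - d v"]) simp
    qed auto
    show "B \<subseteq> int_span B"
    proof
      fix w assume "w \<in> B"
      then have "w = (\<Sum>v\<in>B. real_of_int (if v = w then 1 else 0) *\<^sub>R v)"
        using assms by (simp add: if_distrib[of real_of_int] if_distrib[of "\<lambda>r. r *\<^sub>R _"] cong: if_cong)
      then show "w \<in> int_span B"
        unfolding int_span_def by (intro CollectI exI[of _ "\<lambda>v. if v = w then 1 else 0"]) simp
    qed
  qed
qed

theorem theoremV2p4:
  fixes \<Gamma> B :: "'v::euclidean_space set"
    and a :: "nat \<Rightarrow> 'v" and b :: "nat \<Rightarrow> real" and f :: nat and p :: nat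
  assumes "finite B" and "int_independent B" and "\<Gamma> = int_span B"
    and "closure \<Gamma> = UNIV"
    and "\<forall>i<f. a i \<noteq> 0"
    and "span (a ` {..<f}) = UNIV"
    and "finite (Gamma_orbit \<Gamma> ` singular_points (Cfam \<Gamma> a b f))"
  shows "homology_rat_fin_dim \<Gamma> (CV (Cfam \<Gamma> a b f)) p"
proof -
  have \<Gamma>_eq: "\<Gamma> = gen {} B"
    using assms(3) int_span_eq_gen[OF assms(1)] by simp
  interpret arrangement \<Gamma> a b f
    using assms \<Gamma>_eq submod_gen[of "{}" B] by unfold_locales auto
  obtain S where S: "finite S"
    "\<And>A. finite A \<Longrightarrow> A \<subseteq> walls \<Longrightarrow> cone_ind A \<in> gen (translate ` \<Gamma>) S"
    using cones_finitely_generated by blast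
  have "cone_ring \<subseteq> gen (translate ` \<Gamma>) S"
    unfolding cone_ring_def
    by (rule gen_minimal[OF submod_mono[OF submod_gen]]) (use S(2) in auto)
  then have sub: "CV C \<subseteq> gen (translate ` \<Gamma>) S"
    using CV_subset_cone_ring by blast
  \<comment> \<open>Finite generation passes from the module of cones down to its submodule
    \<open>CV C\<close>; the generators \<open>T\<close> obtained in this way are not
    explicit.\<close>
  have "noeth (translate ` \<Gamma>) (gen (translate ` \<Gamma>) S)"
    unfolding \<Gamma>_eq by (rule translate.noeth_action[OF assms(1) S(1)])
  then obtain T where T: "finite T" "CV C = gen (translate ` \<Gamma>) T"
    by (rule noethE[OF _ sub submod_CV])
  show ?thesis
    by (rule homology_rat_fin_dim_if_fg[OF submod_CV
          bar_homology_finitely_generated[OF translate.bar_axioms assms(1) \<Gamma>_eq T]])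
qed

end
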